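(* Let $K,n_T,n_R\ge 1$ be integers, let $T=n_T$, and let $\mathsf{SNR}>0$. For each user $k\in\{1,\dots,K\}$ let $\mathbf{H}_k=(h^k_{i,j})$ be an $n_R\times n_T$ random matrix, where all entries $h^k_{i,j}$ (over all $k,i,j$) are i.i.d. circularly-symmetric complex Gaussian $\mathcal{CN}(0,1)$. Define the ergodic sum-rate of cyclic delay diversity $$R_c=\mathbb{E}\left[\frac{1}{T}\log_2\det\left(\mathbf{I}_{n_Rn_T}+\frac{\mathsf{SNR}}{n_T}\tilde{\mathbf{H}}\tilde{\mathbf{H}}^H\right)\right],$$ where $\tilde{\mathbf{H}}$ is the effective channel defined in the context. Then $$R_c\ \ge\ \sum_{l=1}^{L}\log_2\left(1+\mathsf{SNR}\,\exp\left(\sum_{k=1}^{M-l}\frac1k-\gamma\right)\right),$$ where $L=\min(n_R,K)$, $M=\max(n_R,K)$, $\gamma\approx0.5772$ is the Euler–Mascheroni constant, and an empty sum equals $0$.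
   Context: Multi-user multiple access channel: $K$ users, each with $n_T$ transmit antennas, a base station with $n_R$ receive antennas; received signal $\mathbf{Y}=\sum_{k=1}^K\sqrt{\mathsf{SNR}/n_T}\,\mathbf{G}_k\mathbf{H}_k^T+\mathbf{N}$ with noise entries i.i.d. $\mathcal{CN}(0,1)$, block length $T=n_T$, and each user $k$ transmits the $T\times T$ cyclic delay diversity (circulant) matrix $\mathbf{G}_k$ whose first row is $(x_1,\dots,x_T)$ and each subsequent row is the previous row cyclically shifted right by one position, with Gaussian codebook inputs. Effective channel: for user $k$ and receive antenna $i$, let $\tilde{\mathbf{H}}_{k,i}$ be the $T\times T$ matrix with $(r,s)$ entry $h^k_{i,\,((r+s-2)\bmod T)+1}$ (so its first row is $(h^k_{i,1},\dots,h^k_{i,T})$ and each next row is the previous one cyclically shifted left by one). Let $\tilde{\mathbf{H}}_k=[\tilde{\mathbf{H}}_{k,1}^T,\dots,\tilde{\mathbf{H}}_{k,n_R}^T]^T$ (size $n_Rn_T\times n_T$) and $\tilde{\mathbf{H}}=[\tilde{\mathbf{H}}_1,\dots,\tilde{\mathbf{H}}_K]$ (size $n_Rn_T\times n_TK$). The receiver uses joint maximum-likelihood detection with full channel knowledge. *)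

theory Defs
  imports "HOL-Probability.Probability" "Jordan_Normal_Form.Determinant"
begin

definition std_complex_gaussian :: "complex measure" where
  "std_complex_gaussian = density lborel (\<lambda>z. ennreal (exp (- (power (cmod z) 2)) / pi))"

text \<open>Channel entries h(k,i,j) (0-based: user k < K, receive antenna i < nR,
  transmit antenna j < nT), all i.i.d. CN(0,1).\<close>
definition channel_measure :: "nat \<Rightarrow> nat \<Rightarrow> nat \<Rightarrow> (nat \<times> nat \<times> nat \<Rightarrow> complex) measure" where
  "channel_measure K nR nT = PiM ({..<K} \<times> {..<nR} \<times> {..<nT}) (\<lambda>_. std_complex_gaussian)"

definition herm :: "complex mat \<Rightarrow> complex mat" where
  "herm A = mat (dim_col A) (dim_row A) (\<lambda>(i,j). cnj (A $$ (j,i)))"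

text \<open>Effective CDD channel (0-based indices): row a = i*nT + r (receive antenna i,
  row r of block), column b = k*nT + s (user k, column s); entry h(k,i,(r+s) mod nT).\<close>
definition eff_channel :: "(nat \<times> nat \<times> nat \<Rightarrow> complex) \<Rightarrow> nat \<Rightarrow> nat \<Rightarrow> nat \<Rightarrow> complex mat" where
  "eff_channel h K nR nT = mat (nR * nT) (nT * K)
     (\<lambda>(a,b). h (b div nT, a div nT, (a mod nT + b mod nT) mod nT))"

text \<open>Ergodic sum rate of CDD with block length T = nT.\<close>
definition cdd_rate :: "nat \<Rightarrow> nat \<Rightarrow> nat \<Rightarrow> real \<Rightarrow> real" where
  "cdd_rate K nR nT snr =
     (\<integral>h. (1 / real nT) * log 2 (Re (Determinant.det
          (1\<^sub>m (nR * nT) + complex_of_real (snr / real nT) \<cdot>\<^sub>m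
             (eff_channel h K nR nT * herm (eff_channel h K nR nT)))))
      \<partial>channel_measure K nR nT)"

end

theory Submission
  imports Defs
begin

text \<open>
  Conjugating by a discrete Fourier transform block-diagonalizes \<open>I + SNR/T H H\<^sup>H\<close>: its determinant is the
  product over the frequencies \<open>f\<close> of \<open>det (I + SNR G G\<^sup>H)\<close> with \<open>G = G\<^sub>f\<close> the matrix of Fourier
  coefficients, and by unitary invariance every \<open>G\<^sub>f\<close> has i.i.d. \<open>CN(0,1)\<close> entries. So it suffices
  to bound the expectation of \<open>ln det (I + SNR G G\<^sup>H)\<close>, where Sylvester's identity lets us choose the
  shorter side \<open>L\<close> as the number of rows. Rotate the last row \<open>v\<close> of \<open>G\<close> onto a coordinate axis; a
  rotation depending only on \<open>v\<close> does not change the law of the other rows. A Schur complement then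
  gives \<open>det \<ge> (1 + SNR |v|\<^sup>2) det'\<close>, where \<open>det'\<close> belongs to the matrix without that row and
  that column. Iterating, the expectation is at least the sum of \<open>E ln (1 + SNR X)\<close> over Erlang
  variables \<open>X\<close> of shape \<open>M, M-1, \<dots>, M-L+1\<close>. By convexity of \<open>ln (1 + SNR exp u)\<close> each term is at least
  \<open>ln (1 + SNR exp (E ln X))\<close>, and \<open>E ln X\<close> is the digamma function at the shape parameter.
\<close>

section \<open>Gram determinants\<close>

text \<open>Both uses of unitary invariance rest on one construction, a product of Givens rotations
  that carries a chosen vector onto a coordinate axis (\<open>exists_row_rotation\<close>). For the
  Fourier step the chosen vector is a normalized Fourier vector: once it has become the unit vector
  at 0, coordinate 0 of every rotated row is the inner product of that row with the Fourier vector,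
  so the entries of \<open>G_f\<close> are coordinates of a family with the original law. Only the
  law of one frequency at a time enters, because the logarithm turns the product over frequencies
  into a sum. When a row is peeled off, the rotation is chosen for one fixed value of that row,
  under the inner integral, so the question of its measurable dependence on the row does not arise.
  The estimates use nonnegative integrals; finiteness is proved separately and makes the Bochner
  integral of the rate a true expectation instead of the default value 0. \<open>E ln X\<close>
  itself is never formed: negative moments of order tending to 0 replace it. The harmonic sum in the
  bound is the Digamma function at an integer, up to \<open>euler_mascheroni\<close>.\<close>

lemma sum_cmod_le_sqrt: "cmod (\<Sum>l\<in>S. x l * y l) \<le> sqrt (\<Sum>l\<in>S. (cmod (x l))\<^sup>2) * sqrt (\<Sum>l\<in>S. (cmod (y l))\<^sup>2)"
proof -
  have "cmod (\<Sum>l\<in>S. x l * y l) \<le> (\<Sum>l\<in>S. \<bar>cmod (x l)\<bar> * \<bar>cmod (y l)\<bar>)"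
    by (rule order_trans[OF norm_sum]) (simp add: norm_mult)
  also have "\<dots> \<le> sqrt (\<Sum>l\<in>S. (cmod (x l))\<^sup>2) * sqrt (\<Sum>l\<in>S. (cmod (y l))\<^sup>2)"
    using L2_set_mult_ineq[of "\<lambda>l. cmod (x l)" "\<lambda>l. cmod (y l)" S] by (simp add: L2_set_def)
  finally show ?thesis .
qed

text \<open>Sylvester's identity. The block matrix \<open>?X\<close> is multiplied on the right by
  two unit triangular block matrices: one clears its upper right block, the other its lower left
  block. Both products have the determinant of \<open>?X\<close>, and each shows one of the two
  sides.\<close>

lemma det_one_plus_mult_commute:
  fixes A B :: "'a :: idom mat"
  assumes A: "A \<in> carrier_mat n m" and B: "B \<in> carrier_mat m n"
  shows "Determinant.det (1\<^sub>m n + A * B) = Determinant.det (1\<^sub>m m + B * A)"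
proof -
  let ?X = "four_block_mat (1\<^sub>m n) (- A) B (1\<^sub>m m)"
  have X: "?X \<in> carrier_mat (n+m) (n+m)" using A B by auto
  have AB: "A * B \<in> carrier_mat n n" and BA: "B * A \<in> carrier_mat m m" using A B by auto
  have mA: "- A \<in> carrier_mat n m" and mB: "- B \<in> carrier_mat m n" using A B by auto
  have "?X * four_block_mat (1\<^sub>m n) A (0\<^sub>m m n) (1\<^sub>m m)
      = four_block_mat (1\<^sub>m n) (0\<^sub>m n m) B (1\<^sub>m m + B * A)"
    by (subst mult_four_block_mat[of _ n n _ m _ m _ _ n _ m])
       (use A B mA BA in \<open>auto simp: comm_add_mat[of "B * A" m m] intro!: arg_cong2[where f="\<lambda>x y. four_block_mat (1\<^sub>m n) x B y"] eq_matI\<close>)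
  hence 1: "Determinant.det ?X * 1 = Determinant.det (1\<^sub>m m + B * A)"
    using det_mult[OF X, of "four_block_mat (1\<^sub>m n) A (0\<^sub>m m n) (1\<^sub>m m)"] A B BA
    by (simp add: det_four_block_mat_lower_left_zero[of _ n _ m] det_four_block_mat_upper_right_zero[of _ n _ m])
  have "?X * four_block_mat (1\<^sub>m n) (0\<^sub>m n m) (- B) (1\<^sub>m m)
      = four_block_mat (1\<^sub>m n + A * B) (- A) (0\<^sub>m m n) (1\<^sub>m m)"
    by (subst mult_four_block_mat[of _ n n _ m _ m _ _ n _ m])
       (use A B mA mB AB in \<open>auto intro!: arg_cong2[where f="\<lambda>x y. four_block_mat x (- A) y (1\<^sub>m m)"] eq_matI\<close>)
  hence 2: "Determinant.det ?X * 1 = Determinant.det (1\<^sub>m n + A * B)"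
    using det_mult[OF X, of "four_block_mat (1\<^sub>m n) (0\<^sub>m n m) (- B) (1\<^sub>m m)"] A B AB mA mB
    by (simp add: det_four_block_mat_lower_left_zero[of _ n _ m] det_four_block_mat_upper_right_zero[of _ n _ m])
  show ?thesis using 1 2 by simp
qed

text \<open>The matrix determinant lemma with the inverse replaced by a solution \<open>x\<close> of
  \<open>P x = z\<close>. The updated matrix factors as \<open>P (1 + x y)\<close>, with
  \<open>x\<close> a column and \<open>y\<close> a row, and Sylvester reduces the second factor to
  size 1.\<close>

lemma det_add_rank_one:
  fixes P :: "'a :: idom mat"
  assumes P: "P \<in> carrier_mat n n" and Px: "\<And>l. l < n \<Longrightarrow> (\<Sum>m<n. P $$ (l,m) * x m) = z l"
  shows "Determinant.det (mat n n (\<lambda>(l,m). P $$ (l,m) + z l * y m)) = Determinant.det P * (1 + (\<Sum>l<n. y l * x l))"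
proof -
  define X where "X = mat n 1 (\<lambda>(l,_). x l)"
  define Y where "Y = mat 1 n (\<lambda>(_,l). y l)"
  have XC: "X \<in> carrier_mat n 1" and YC: "Y \<in> carrier_mat 1 n" by (auto simp: X_def Y_def)
  have XY: "X * Y \<in> carrier_mat n n" by (rule mult_carrier_mat[OF XC YC])
  have PX: "P * X = mat n 1 (\<lambda>(l,_). z l)"
    using P by (intro eq_matI) (auto simp: X_def scalar_prod_def Px[symmetric] lessThan_atLeast0)
  have "mat n n (\<lambda>(l,m). P $$ (l,m) + z l * y m) = P + (P * X) * Y"
    unfolding PX using P by (intro eq_matI) (auto simp: Y_def scalar_prod_def)
  also have "\<dots> = P * (1\<^sub>m n + X * Y)"
    using P XY by (subst mult_add_distrib_mat[of _ n n]) (auto simp: assoc_mult_mat[OF P XC YC])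
  also have "Determinant.det \<dots> = Determinant.det P * Determinant.det (1\<^sub>m n + X * Y)"
    using P XY by (intro det_mult) auto
  also have "Determinant.det (1\<^sub>m n + X * Y) = Determinant.det (1\<^sub>m 1 + Y * X)"
    by (rule det_one_plus_mult_commute[OF XC YC])
  also have "\<dots> = 1 + (\<Sum>l<n. y l * x l)"
    by (subst det_single) (auto simp: X_def Y_def scalar_prod_def lessThan_atLeast0)
  finally show ?thesis .
qed

text \<open>The matrix \<open>I + rho A A^H\<close>. The columns are indexed by a set, so that
  single columns can be added or removed without renumbering; the rows are numbered, so that the
  last one can be split off as a block.\<close>

definition gram :: "real \<Rightarrow> 'c set \<Rightarrow> (nat \<Rightarrow> 'c \<Rightarrow> complex) \<Rightarrow> nat \<Rightarrow> complex mat" where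
  "gram \<rho> J A n = mat n n (\<lambda>(l,m). (if l = m then 1 else 0) + complex_of_real \<rho> * (\<Sum>i\<in>J. A l i * cnj (A m i)))"

lemma gram_carrier [simp]: "gram \<rho> J A n \<in> carrier_mat n n"
  by (simp add: gram_def)

lemma dim_gram [simp]: "dim_row (gram \<rho> J A n) = n" "dim_col (gram \<rho> J A n) = n"
  by (simp_all add: gram_def)

text \<open>Expanding \<open>x^H (I + rho A A^H) x\<close> shows that it is real and, for
  nonnegative \<open>rho\<close>, at least the squared norm of \<open>x\<close>. This is how
  positivity enters the determinant estimates.\<close>

lemma gram_quadratic_form:
  "(\<Sum>l<n. cnj (x l) * (\<Sum>m<n. gram \<rho> J A n $$ (l,m) * x m)) =
     complex_of_real ((\<Sum>l<n. (cmod (x l))\<^sup>2) + \<rho> * (\<Sum>i\<in>J. (cmod (\<Sum>l<n. cnj (x l) * A l i))\<^sup>2))"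
proof -
  have sq: "complex_of_real ((cmod (\<Sum>l<n. cnj (x l) * A l i))\<^sup>2)
      = (\<Sum>l<n. \<Sum>m<n. cnj (x l) * A l i * cnj (A m i) * x m)" for i
    by (simp add: complex_norm_square[unfolded of_real_power] sum_product mult_ac) (rule sum.swap)
  have "(\<Sum>l<n. cnj (x l) * (\<Sum>m<n. gram \<rho> J A n $$ (l,m) * x m)) =
     (\<Sum>l<n. \<Sum>m<n. (if l = m then cnj (x l) * x m else 0) + complex_of_real \<rho> * (\<Sum>i\<in>J. cnj (x l) * A l i * cnj (A m i) * x m))"
    unfolding sum_distrib_left
    by (intro sum.cong refl) (auto simp: gram_def algebra_simps sum_distrib_left sum_distrib_right)
  also have "\<dots> = (\<Sum>l<n. cnj (x l) * x l) + complex_of_real \<rho> * (\<Sum>l<n. \<Sum>m<n. \<Sum>i\<in>J. cnj (x l) * A l i * cnj (A m i) * x m)"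
    unfolding sum.distrib sum_distrib_left by (auto intro!: sum.cong)
  also have "(\<Sum>l<n. \<Sum>m<n. \<Sum>i\<in>J. cnj (x l) * A l i * cnj (A m i) * x m)
    = (\<Sum>i\<in>J. \<Sum>l<n. \<Sum>m<n. cnj (x l) * A l i * cnj (A m i) * x m)"
    by (simp only: sum.swap[where A = "{..<n}" and B = J])
  also have "(\<Sum>l<n. cnj (x l) * x l) = complex_of_real (\<Sum>l<n. (cmod (x l))\<^sup>2)"
    by (simp add: complex_norm_square[unfolded of_real_power] mult.commute)
  finally show ?thesis by (simp add: sq[symmetric])
qed

text \<open>A new column \<open>a\<close> is a rank-one update of \<open>P = gram rho J A n\<close>,
  and \<open>t\<close> is \<open>a^H P^(-1) a\<close>. With \<open>x = P^(-1) a\<close> this equals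
  \<open>x^H P x\<close>, hence is real and nonnegative. The upper bound expresses that
  \<open>P\<close> is at least the identity.\<close>

lemma det_gram_insert:
  assumes J: "finite J" "j \<notin> J" and \<rho>: "\<rho> \<ge> 0" and nz: "Determinant.det (gram \<rho> J A n) \<noteq> 0"
  obtains t where "0 \<le> t" "t \<le> (\<Sum>l<n. (cmod (A l j))\<^sup>2)"
    "Determinant.det (gram \<rho> (insert j J) A n) = Determinant.det (gram \<rho> J A n) * complex_of_real (1 + \<rho> * t)"
proof -
  let ?P = "gram \<rho> J A n"
  obtain Q where Q: "Q \<in> carrier_mat n n" "?P * Q = 1\<^sub>m n"
    using det_non_zero_imp_unit[OF gram_carrier nz] unfolding Units_def ring_mat_def by auto
  define x where "x m = (\<Sum>k<n. Q $$ (m,k) * A k j)" for m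
  have PQ: "(\<Sum>m<n. ?P $$ (l,m) * Q $$ (m,k)) = (if l = k then 1 else 0)" if "l < n" "k < n" for l k
  proof -
    have "(?P * Q) $$ (l,k) = (\<Sum>m<n. ?P $$ (l,m) * Q $$ (m,k))"
      using that Q(1) by (simp add: scalar_prod_def lessThan_atLeast0)
    thus ?thesis using that Q(2) by simp
  qed
  have Px: "(\<Sum>m<n. ?P $$ (l,m) * x m) = A l j" if l: "l < n" for l
  proof -
    have "(\<Sum>m<n. ?P $$ (l,m) * x m) = (\<Sum>k<n. (\<Sum>m<n. ?P $$ (l,m) * Q $$ (m,k)) * A k j)"
      unfolding x_def sum_distrib_left sum_distrib_right by (subst sum.swap) (simp add: mult_ac)
    also have "\<dots> = (\<Sum>k<n. if l = k then A k j else 0)"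
      using l by (intro sum.cong) (auto simp: PQ)
    also have "\<dots> = A l j" using l by simp
    finally show ?thesis .
  qed
  define t where "t = (\<Sum>l<n. (cmod (x l))\<^sup>2) + \<rho> * (\<Sum>i\<in>J. (cmod (\<Sum>l<n. cnj (x l) * A l i))\<^sup>2)"
  define X Z where "X = sqrt (\<Sum>l<n. (cmod (x l))\<^sup>2)" and "Z = sqrt (\<Sum>l<n. (cmod (A l j))\<^sup>2)"
  have X2: "X\<^sup>2 = (\<Sum>l<n. (cmod (x l))\<^sup>2)" "X \<ge> 0" and Z2: "Z\<^sup>2 = (\<Sum>l<n. (cmod (A l j))\<^sup>2)" "Z \<ge> 0"
    by (auto simp: X_def Z_def sum_nonneg)
  have t_eq: "complex_of_real t = (\<Sum>l<n. cnj (x l) * A l j)"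
    unfolding t_def gram_quadratic_form[symmetric] by (intro sum.cong) (auto simp: Px)
  have tX: "X\<^sup>2 \<le> t" unfolding t_def X2 using \<rho> by (simp add: sum_nonneg)
  have t0: "t \<ge> 0" using tX by (meson order_trans zero_le_power2)
  have "t = cmod (\<Sum>l<n. cnj (x l) * A l j)" using t0 by (simp add: t_eq[symmetric])
  also have "\<dots> \<le> X * Z" using sum_cmod_le_sqrt[of "\<lambda>l. cnj (x l)" "\<lambda>l. A l j" "{..<n}"] by (simp add: X_def Z_def)
  finally have tXZ: "t \<le> X * Z" .
  \<comment> \<open>Here \<open>X\<close> and \<open>Z\<close> are the norms of \<open>x\<close> and
    of the new column. The quadratic form and Cauchy-Schwarz give
    \<open>X * X \<le> t \<le> X * Z\<close>, so \<open>X\<close> can be cancelled unless it is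
    0.\<close>
  have "X \<le> Z"
  proof (cases "X = 0")
    case False
    with tX tXZ X2 show ?thesis by (metis mult_le_cancel_left_pos order_trans power2_eq_square less_eq_real_def)
  qed (use Z2 in simp)
  hence tZ: "t \<le> Z\<^sup>2" using tXZ Z2(2) X2(2) by (metis mult_right_mono order_trans power2_eq_square)
  have "gram \<rho> (insert j J) A n = mat n n (\<lambda>(l,m). ?P $$ (l,m) + A l j * (complex_of_real \<rho> * cnj (A m j)))"
    using J by (intro eq_matI) (auto simp: gram_def algebra_simps)
  hence "Determinant.det (gram \<rho> (insert j J) A n) = Determinant.det ?P * (1 + (\<Sum>l<n. complex_of_real \<rho> * cnj (A l j) * x l))"
    using det_add_rank_one[OF gram_carrier Px, where y = "\<lambda>l. complex_of_real \<rho> * cnj (A l j)"] by simp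
  also have "(\<Sum>l<n. complex_of_real \<rho> * cnj (A l j) * x l) = complex_of_real \<rho> * cnj (complex_of_real t)"
    unfolding t_eq by (simp add: sum_distrib_left mult_ac)
  finally show ?thesis using that[of t] t0 tZ Z2 by simp
qed

text \<open>Starting from the identity matrix, each inserted column multiplies the determinant by a
  factor between 1 and \<open>1 + rho\<close> times the squared norm of the column. The lower bound
  makes logarithms nonnegative; the upper one, of Hadamard type, serves for integrability.\<close>

lemma det_gram_bounds:
  assumes "finite J" and \<rho>: "\<rho> \<ge> 0"
  obtains d where "Determinant.det (gram \<rho> J A n) = complex_of_real d" "1 \<le> d"
    "d \<le> (\<Prod>i\<in>J. 1 + \<rho> * (\<Sum>l<n. (cmod (A l i))\<^sup>2))"
proof -
  have "\<exists>d\<ge>1. Determinant.det (gram \<rho> J A n) = complex_of_real d \<and>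
     d \<le> (\<Prod>i\<in>J. 1 + \<rho> * (\<Sum>l<n. (cmod (A l i))\<^sup>2))"
    using \<open>finite J\<close>
  proof induction
    case empty
    have "gram \<rho> {} A n = 1\<^sub>m n" by (intro eq_matI) (auto simp: gram_def)
    then show ?case by (intro exI[of _ 1]) simp
  next
    case (insert j J)
    then obtain d where d: "d \<ge> 1" "Determinant.det (gram \<rho> J A n) = complex_of_real d"
      "d \<le> (\<Prod>i\<in>J. 1 + \<rho> * (\<Sum>l<n. (cmod (A l i))\<^sup>2))" by blast
    then have "Determinant.det (gram \<rho> J A n) \<noteq> 0" by auto
    from det_gram_insert[OF insert.hyps \<rho> this]
    obtain t where t: "0 \<le> t" "t \<le> (\<Sum>l<n. (cmod (A l j))\<^sup>2)"
      "Determinant.det (gram \<rho> (insert j J) A n) = complex_of_real d * complex_of_real (1 + \<rho> * t)"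
      using d by metis
    have "1 + \<rho> * t \<le> 1 + \<rho> * (\<Sum>l<n. (cmod (A l j))\<^sup>2)" "1 \<le> 1 + \<rho> * t"
      using t \<rho> by (auto simp: mult_left_mono)
    then have "d * (1 + \<rho> * t) \<ge> 1" "d * (1 + \<rho> * t) \<le> (\<Prod>i\<in>insert j J. 1 + \<rho> * (\<Sum>l<n. (cmod (A l i))\<^sup>2))"
      using d insert.hyps by (auto simp: mult.commute[of d] intro!: mult_mono mult_ge1_I)
    then show ?case using t(3) by (intro exI[of _ "d * (1 + \<rho> * t)"]) simp
  qed
  then show ?thesis using that by blast
qed

lemma det_gram_mono:
  assumes "finite J" "\<rho> \<ge> 0"
  shows "Re (Determinant.det (gram \<rho> J A n)) \<le> Re (Determinant.det (gram \<rho> (insert j J) A n))"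
proof (cases "j \<in> J")
  case False
  obtain d where d: "Determinant.det (gram \<rho> J A n) = complex_of_real d" "1 \<le> d"
    using det_gram_bounds[OF assms] .
  then have "Determinant.det (gram \<rho> J A n) \<noteq> 0" by auto
  from det_gram_insert[OF assms(1) False assms(2) this]
  obtain t where t: "0 \<le> t" 
      "Determinant.det (gram \<rho> (insert j J) A n) = complex_of_real d * complex_of_real (1 + \<rho> * t)"
      using d by metis
  have "Re (Determinant.det (gram \<rho> (insert j J) A n)) = d * (1 + \<rho> * t)" by (simp only: t(2) Re_complex_of_real of_real_mult[symmetric])
  moreover have "d * 1 \<le> d * (1 + \<rho> * t)" using t d assms by (intro mult_left_mono) auto
  ultimately show ?thesis using d by simp
qed (simp add: insert_absorb)

text \<open>The Schur complement of the last diagonal entry is again a Gram matrix, whose column \<open>i\<close> is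
  scaled down; dropping that column can only decrease the determinant.\<close>

lemma det_gram_Suc_ge:
  assumes J: "finite J" "i \<in> J" and \<rho>: "\<rho> \<ge> 0" and zero: "\<And>k. k \<in> J \<Longrightarrow> k \<noteq> i \<Longrightarrow> A n k = 0"
  shows "(1 + \<rho> * (cmod (A n i))\<^sup>2) * Re (Determinant.det (gram \<rho> (J - {i}) A n))
    \<le> Re (Determinant.det (gram \<rho> J A (Suc n)))"
proof -
  define d where "d = 1 + \<rho> * (cmod (A n i))\<^sup>2"
  have d: "d \<ge> 1" using \<rho> by (simp add: d_def)
  have dc: "complex_of_real d = 1 + complex_of_real \<rho> * (A n i * cnj (A n i))"
    by (simp add: d_def complex_norm_square[unfolded of_real_power])
  \<comment> \<open>Eliminating the last row leaves in the term of column \<open>i\<close> the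
    factor \<open>(d - rho * (cmod (A n i))^2) / d = 1 / d\<close>. Dividing that column by
    \<open>sqrt d\<close> absorbs it, so the Schur complement is a Gram matrix again.\<close>
  define A' where "A' l k = (if k = i then A l k / complex_of_real (sqrt d) else A l k)" for l k
  define u where "u l = complex_of_real \<rho> * A l i * cnj (A n i)" for l
  have sumn: "(\<Sum>k\<in>J. f k * cnj (A n k)) = f i * cnj (A n i)" "(\<Sum>k\<in>J. A n k * f k) = A n i * f i" for f
    using J zero by (auto simp: sum.remove[of J i] intro!: sum.neutral)
  have block: "gram \<rho> J A (Suc n) = four_block_mat (gram \<rho> J A n) (mat n 1 (\<lambda>(l,_). u l))
     (mat 1 n (\<lambda>(_,l). cnj (u l))) (mat 1 1 (\<lambda>_. complex_of_real d))"
    by (intro eq_matI) (auto simp: gram_def u_def sumn dc less_Suc_eq mult_ac)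
  have sd: "complex_of_real (sqrt d) * complex_of_real (sqrt d) = complex_of_real d"
    using d by (simp flip: of_real_mult)
  have schur: "gram \<rho> J A n $$ (l,m) - u l * (cnj (u m) / complex_of_real d) = gram \<rho> J A' n $$ (l,m)"
    if "l < n" "m < n" for l m
  proof -
    have S: "(\<Sum>k\<in>J. A' l k * cnj (A' m k)) = A l i * cnj (A m i) / complex_of_real d + (\<Sum>k\<in>J-{i}. A l k * cnj (A m k))"
      using J sd by (subst sum.remove[of J i]) (auto simp: A'_def intro!: sum.cong)
    have S': "(\<Sum>k\<in>J. A l k * cnj (A m k)) = A l i * cnj (A m i) + (\<Sum>k\<in>J-{i}. A l k * cnj (A m k))"
      using J by (subst sum.remove[of J i]) auto
    have dnz: "complex_of_real d \<noteq> 0" using d by auto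
    have "complex_of_real \<rho> * (A l i * cnj (A m i)) - u l * (cnj (u m) / complex_of_real d)
       = complex_of_real \<rho> * (A l i * cnj (A m i)) * (complex_of_real d - complex_of_real \<rho> * (A n i * cnj (A n i))) / complex_of_real d"
      using dnz by (simp add: u_def field_simps)
    also have "\<dots> = complex_of_real \<rho> * (A l i * cnj (A m i)) / complex_of_real d" by (simp add: dc)
    finally show ?thesis using that by (simp add: gram_def S S' algebra_simps)
  qed
  \<comment> \<open>Right multiplication by this unit triangular matrix clears the last row left of
    the corner \<open>d\<close>.\<close>
  let ?E = "four_block_mat (1\<^sub>m n) (0\<^sub>m n 1) (mat 1 n (\<lambda>(_,l). - cnj (u l) / complex_of_real d)) (1\<^sub>m 1)"
  have dnz: "complex_of_real d \<noteq> 0" using d by auto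
  have sch: "gram \<rho> J A n * 1\<^sub>m n + mat n 1 (\<lambda>(l,_). u l) * mat 1 n (\<lambda>(_,l). - cnj (u l) / complex_of_real d) = gram \<rho> J A' n"
  proof (rule eq_matI)
    fix l m assume "l < dim_row (gram \<rho> J A' n)" "m < dim_col (gram \<rho> J A' n)"
    hence lm: "l < n" "m < n" by (auto simp: gram_def)
    show "(gram \<rho> J A n * 1\<^sub>m n + mat n 1 (\<lambda>(l,_). u l) * mat 1 n (\<lambda>(_,l). - cnj (u l) / complex_of_real d)) $$ (l,m) = gram \<rho> J A' n $$ (l,m)"
      using lm schur[OF lm] right_mult_one_mat[OF gram_carrier[of \<rho> J A n]] by (simp add: scalar_prod_def)
  qed (auto simp: gram_def)
  have "gram \<rho> J A (Suc n) * ?E = four_block_mat (gram \<rho> J A' n) (mat n 1 (\<lambda>(l,_). u l)) (0\<^sub>m 1 n) (mat 1 1 (\<lambda>_. complex_of_real d))"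
    unfolding block
    apply (subst mult_four_block_mat[of _ n n _ 1 _ 1 _ _ n _ 1])
            apply (auto simp only: gram_carrier one_carrier_mat zero_carrier_mat mat_carrier sch)
    apply (rule arg_cong3[where f="four_block_mat (gram \<rho> J A' n)"])
      apply (use dnz in \<open>auto intro!: eq_matI simp: scalar_prod_def gram_def\<close>)
    done
  moreover have "?E \<in> carrier_mat (n + 1) (n + 1)" by (rule four_block_carrier_mat) auto
  moreover have "Determinant.det (four_block_mat (gram \<rho> J A' n) (mat n 1 (\<lambda>(l,_). u l)) (0\<^sub>m 1 n) (mat 1 1 (\<lambda>_. complex_of_real d)))
      = Determinant.det (gram \<rho> J A' n) * complex_of_real d"
    by (subst det_four_block_mat_lower_left_zero[of _ n _ 1]) (auto simp: det_single)
  ultimately have "Determinant.det (gram \<rho> J A (Suc n)) * Determinant.det ?E = Determinant.det (gram \<rho> J A' n) * complex_of_real d"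
    using det_mult[OF gram_carrier[of \<rho> J A "Suc n"], of ?E] by simp
  moreover have "Determinant.det ?E = 1"
    by (subst det_four_block_mat_upper_right_zero[of _ n _ 1]) auto
  ultimately have "Determinant.det (gram \<rho> J A (Suc n)) = complex_of_real d * Determinant.det (gram \<rho> J A' n)" by simp
  then have "Re (Determinant.det (gram \<rho> J A (Suc n))) = d * Re (Determinant.det (gram \<rho> J A' n))" by simp
  moreover have "gram \<rho> (J - {i}) A' n = gram \<rho> (J - {i}) A n"
    by (auto simp: gram_def A'_def intro!: eq_matI sum.cong)
  moreover have "Re (Determinant.det (gram \<rho> (J - {i}) A' n)) \<le> Re (Determinant.det (gram \<rho> J A' n))"
    using det_gram_mono[of "J - {i}" \<rho> A' n i] J \<rho> by (simp add: insert_absorb)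
  ultimately show ?thesis using d by (auto simp: d_def intro!: mult_left_mono)
qed

section \<open>Diagonalizing the effective channel by the discrete Fourier transform\<close>

lemma sum_lessThan_mult_divmod:
  "(\<Sum>b<n*T. g (b div T) (b mod T)) = (\<Sum>i<n. \<Sum>r<T. g i (r::nat))"
proof (cases "T = 0")
  case False
  have "(\<Sum>b<n*T. g (b div T) (b mod T)) = (\<Sum>i<n. \<Sum>b\<in>{i*T..<i*T+T}. g (b div T) (b mod T))"
    by (rule sum.nat_group[symmetric])
  also have "\<dots> = (\<Sum>i<n. \<Sum>r<T. g i r)"
  proof (rule sum.cong[OF refl])
    fix i
    have "(\<Sum>b\<in>{i*T..<i*T+T}. g (b div T) (b mod T)) = (\<Sum>r\<in>{0..<T}. g ((r + i*T) div T) ((r + i*T) mod T))"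
      using sum.shift_bounds_nat_ivl[of "\<lambda>b. g (b div T) (b mod T)" 0 "i*T" T] by (simp add: add.commute)
    also have "\<dots> = (\<Sum>r<T. g i r)"
      using False by (intro sum.cong) auto
    finally show "(\<Sum>b\<in>{i*T..<i*T+T}. g (b div T) (b mod T)) = (\<Sum>r<T. g i r)" .
  qed
  finally show ?thesis .
qed simp

lemma det_block_diagonal:
  fixes B :: "nat \<Rightarrow> nat \<Rightarrow> nat \<Rightarrow> 'a :: idom"
  assumes n: "n > 0"
  shows "Determinant.det (mat (T*n) (T*n) (\<lambda>(a,b). if a div n = b div n then B (a div n) (a mod n) (b mod n) else 0))
    = (\<Prod>f<T. Determinant.det (mat n n (\<lambda>(i,j). B f i j)))"
proof (induction T)
  case (Suc T)
  let ?M = "\<lambda>T. mat (T*n) (T*n) (\<lambda>(a,b). if a div n = b div n then B (a div n) (a mod n) (b mod n) else 0)"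
  have div: "a div n = T" "a mod n = a - T * n" if "\<not> a < T * n" "a < n + T * n" for a
  proof -
    have *: "a = (a - T * n) + T * n" "a - T * n < n" using that by auto
    show "a div n = T" "a mod n = a - T * n"
      by (subst *(1), use *(2) in simp)+
  qed
  have lt: "a div n < T" if "a < T * n" for a
    using that by (simp add: less_mult_imp_div_less)
  have M: "?M (Suc T) = four_block_mat (?M T) (0\<^sub>m (T*n) n) (0\<^sub>m n (T*n)) (mat n n (\<lambda>(i,j). B T i j))"
  proof (rule eq_matI)
    fix a b
    assume "a < dim_row (four_block_mat (?M T) (0\<^sub>m (T*n) n) (0\<^sub>m n (T*n)) (mat n n (\<lambda>(i,j). B T i j)))"
      "b < dim_col (four_block_mat (?M T) (0\<^sub>m (T*n) n) (0\<^sub>m n (T*n)) (mat n n (\<lambda>(i,j). B T i j)))"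
    then have ab: "a < n + T * n" "b < n + T * n" by auto
    consider "a < T * n" "b < T * n" | "a < T * n" "\<not> b < T * n" | "\<not> a < T * n" "b < T * n"
      | "\<not> a < T * n" "\<not> b < T * n" by blast
    then show "?M (Suc T) $$ (a, b) = four_block_mat (?M T) (0\<^sub>m (T*n) n) (0\<^sub>m n (T*n)) (mat n n (\<lambda>(i,j). B T i j)) $$ (a, b)"
    proof cases
      case 2
      then show ?thesis using ab lt[of a] div(1)[of b] by simp
    next
      case 3
      then show ?thesis using ab lt[of b] div(1)[of a] by simp
    next
      case 4
      then show ?thesis using ab div[of a] div[of b] by simp
    qed (use ab in simp)
  qed auto
  have "Determinant.det (?M (Suc T)) = Determinant.det (?M T) * Determinant.det (mat n n (\<lambda>(i,j). B T i j))"
    unfolding M by (rule det_four_block_mat_lower_left_zero[of _ "T*n" _ n]) auto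
  then show ?case by (simp only: Suc.IH prod.lessThan_Suc)
qed simp

text \<open>Sylvester turns \<open>I + rho A A^H\<close> into \<open>I + rho A^H A\<close>. Its
  plain transpose has the conjugates on the other factor and is therefore the Gram matrix of the
  transposed array, with no conjugation of the entries.\<close>

lemma det_gram_transpose:
  "Determinant.det (gram \<rho> {..<m} A n) = Determinant.det (gram \<rho> {..<n} (\<lambda>k i. A i k) m)"
proof -
  define X Y where "X = mat n m (\<lambda>(l,k). complex_of_real \<rho> * A l k)" and "Y = mat m n (\<lambda>(k,l). cnj (A l k))"
  have C: "X \<in> carrier_mat n m" "Y \<in> carrier_mat m n" by (auto simp: X_def Y_def)
  have "gram \<rho> {..<m} A n = 1\<^sub>m n + X * Y"
    using C by (intro eq_matI) (auto simp: gram_def X_def Y_def scalar_prod_def sum_distrib_left lessThan_atLeast0 mult_ac)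
  then have "Determinant.det (gram \<rho> {..<m} A n) = Determinant.det (1\<^sub>m m + Y * X)"
    using det_one_plus_mult_commute[OF C] by simp
  also have "\<dots> = Determinant.det (transpose_mat (1\<^sub>m m + Y * X))"
    using C by (subst det_transpose[of _ m]) auto
  also have "transpose_mat (1\<^sub>m m + Y * X) = gram \<rho> {..<n} (\<lambda>k i. A i k) m"
    using C by (intro eq_matI) (auto simp: gram_def X_def Y_def scalar_prod_def sum_distrib_left lessThan_atLeast0 mult_ac)
  finally show ?thesis .
qed

section \<open>Roots of unity and Fourier coefficients\<close>

definition unit_root :: "nat \<Rightarrow> nat \<Rightarrow> complex" where
  "unit_root T f = exp (2 * of_real pi * \<i> * of_nat f / of_nat T)"

lemma unit_root_power: "T > 0 \<Longrightarrow> unit_root T f ^ T = 1"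
  unfolding unit_root_def by (rule complex_root_unity) simp

lemma norm_unit_root [simp]: "cmod (unit_root T f) = 1"
  unfolding unit_root_def by (simp add: norm_exp_eq_Re)

lemma unit_root_cnj: "unit_root T f ^ m * cnj (unit_root T f) ^ m = 1"
  by (simp add: complex_norm_square[symmetric] flip: power_mult_distrib)

lemma sum_unit_root_orthogonal:
  assumes "f < T" "g < T"
  shows "(\<Sum>r<T. unit_root T f ^ r * cnj (unit_root T g) ^ r) = (if f = g then of_nat T else 0)"
proof (cases "f = g")
  case False
  let ?z = "unit_root T f * cnj (unit_root T g)"
  have T: "T > 0" using assms by simp
  have "?z \<noteq> 1"
  proof
    assume z: "?z = 1"
    have "unit_root T f = ?z * unit_root T g"
      using unit_root_cnj[of T g 1] by (simp add: mult_ac)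
    then have "unit_root T f = unit_root T g" using z by simp
    then show False
      using complex_root_unity_eq[of T f g] T assms False by (auto simp: unit_root_def)
  qed
  moreover have "?z ^ T = 1"
    using unit_root_power[OF T] by (simp add: power_mult_distrib flip: complex_cnj_power)
  ultimately have "(\<Sum>r<T. ?z ^ r) = 0"
    by (simp add: sum_gp_strict)
  then show ?thesis using False by (simp add: power_mult_distrib)
qed (simp add: unit_root_cnj)

text \<open>The Fourier coefficient over the transmit antennas, arranged with receive antennas as
  rows and users as columns. The factor \<open>1 / sqrt T\<close> makes the weights a unit vector,
  so that the coefficients keep variance 1.\<close>

definition dft_channel :: "(nat \<times> nat \<times> nat \<Rightarrow> complex) \<Rightarrow> nat \<Rightarrow> nat \<Rightarrow> nat \<Rightarrow> nat \<Rightarrow> complex" where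
  "dft_channel h T f i k = (\<Sum>m<T. cnj (unit_root T f) ^ m / complex_of_real (sqrt T) * h (k, i, m))"

text \<open>The shift theorem, by substituting \<open>m = (r + s) mod T\<close>. It says that one
  Fourier row applied to a circulant block is a multiple of the vector of powers
  \<open>unit_root T f ^ s\<close>; such vectors are orthogonal for different frequencies, which is
  why multiplication from the left alone separates the frequencies.\<close>

lemma dft_cyclic_shift:
  assumes T: "T > 0"
  shows "(\<Sum>r<T. cnj (unit_root T f) ^ r / complex_of_real (sqrt T) * h (k, i, (r + s) mod T)) = unit_root T f ^ s * dft_channel h T f i k"
proof -
  have mod: "x ^ (m mod T) = x ^ m" if "x ^ T = 1" for x :: complex and m
  proof -
    have "x ^ m = x ^ (m mod T + T * (m div T))" by simp
    also have "\<dots> = x ^ (m mod T)" unfolding power_add power_mult that by simp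
    finally show ?thesis by simp
  qed
  have cT: "cnj (unit_root T f) ^ T = 1"
    using unit_root_power[OF T, of f] by (metis complex_cnj_one complex_cnj_power)
  have bij: "bij_betw (\<lambda>r. (r + s) mod T) {..<T} {..<T}"
  proof -
    have "inj_on (\<lambda>r. (r + s) mod T) {..<T}"
    proof (rule inj_onI)
      fix x y assume xy: "x \<in> {..<T}" "y \<in> {..<T}" "(x + s) mod T = (y + s) mod T"
      then have "(int x + int s) mod int T = (int y + int s) mod int T" by (metis of_nat_add zmod_int)
      then have "int T dvd int x - int y" by (simp add: mod_eq_dvd_iff)
      then show "x = y" using xy dvd_imp_le_int[of "int x - int y" "int T"] by (cases "x = y") auto
    qed
    moreover have "(\<lambda>r. (r + s) mod T) ` {..<T} \<subseteq> {..<T}" using T by auto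
    ultimately show ?thesis by (simp add: bij_betw_def endo_inj_surj)
  qed
  have "unit_root T f ^ s * dft_channel h T f i k
     = (\<Sum>m<T. unit_root T f ^ s * (cnj (unit_root T f) ^ m / complex_of_real (sqrt T) * h (k, i, m)))"
    by (simp add: dft_channel_def sum_distrib_left)
  also have "\<dots> = (\<Sum>r<T. unit_root T f ^ s * (cnj (unit_root T f) ^ ((r + s) mod T) / complex_of_real (sqrt T) * h (k, i, (r + s) mod T)))"
    by (rule sum.reindex_bij_betw[OF bij, symmetric])
  also have "\<dots> = (\<Sum>r<T. (unit_root T f ^ s * cnj (unit_root T f) ^ s) * (cnj (unit_root T f) ^ r / complex_of_real (sqrt T) * h (k, i, (r + s) mod T)))"
    by (simp add: mod[OF cT] power_add mult_ac)
  also have "\<dots> = (\<Sum>r<T. cnj (unit_root T f) ^ r / complex_of_real (sqrt T) * h (k, i, (r + s) mod T))"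
    by (simp add: unit_root_cnj)
  finally show ?thesis by simp
qed

section \<open>Conjugate transposes and the determinant of the effective channel\<close>

lemma herm_carrier: "A \<in> carrier_mat n m \<Longrightarrow> herm A \<in> carrier_mat m n"
  by (auto simp: herm_def)

lemma mult_herm_index:
  "A \<in> carrier_mat n m \<Longrightarrow> a < n \<Longrightarrow> b < n \<Longrightarrow> (A * herm A) $$ (a,b) = (\<Sum>c<m. A $$ (a,c) * cnj (A $$ (b,c)))"
  by (auto simp: herm_def scalar_prod_def lessThan_atLeast0)

lemma one_plus_smult_index:
  "Z \<in> carrier_mat n n \<Longrightarrow> a < n \<Longrightarrow> b < n \<Longrightarrow> (1\<^sub>m n + c \<cdot>\<^sub>m Z) $$ (a,b) = (if a = b then 1 else 0) + c * Z $$ (a,b)"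
  by auto

lemma herm_mult: "A \<in> carrier_mat n m \<Longrightarrow> B \<in> carrier_mat m p \<Longrightarrow> herm (A * B) = herm B * herm A"
  by (intro eq_matI) (auto simp: herm_def scalar_prod_def mult.commute)

text \<open>The rows of the unitary matrix \<open>W\<close> are indexed by \<open>f * nR + i\<close>, so that conjugation by it
  both diagonalizes the circulant blocks and collects the entries belonging to one frequency \<open>f\<close>.\<close>

lemma det_eff_channel:
  assumes T: "T > 0" and nR: "nR > 0"
  shows "Determinant.det (1\<^sub>m (nR * T) + complex_of_real (\<rho> / real T) \<cdot>\<^sub>m
           (eff_channel h K nR T * herm (eff_channel h K nR T)))
    = (\<Prod>f<T. Determinant.det (gram \<rho> {..<K} (dft_channel h T f) nR))"
proof -
  define N where "N = nR * T"
  define w where "w f r = cnj (unit_root T f) ^ r / complex_of_real (sqrt T)" for f r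
  define W where "W = mat N N (\<lambda>(a,b). if a mod nR = b div T then w (a div nR) (b mod T) else 0)"
  define H where "H = eff_channel h K nR T"
  have W: "W \<in> carrier_mat N N" and H: "H \<in> carrier_mat N (T * K)"
    by (auto simp: W_def H_def eff_channel_def N_def)
  have hW: "herm W \<in> carrier_mat N N" and hH: "herm H \<in> carrier_mat (T * K) N"
    using W H by (auto intro: herm_carrier)
  have sT: "complex_of_real (sqrt T) * complex_of_real (sqrt T) = of_nat T"
    by (simp flip: of_real_mult)
  have cT: "(of_nat T :: complex) \<noteq> 0" using T by simp
  have divN: "a div nR < T" "a mod nR < nR" if "a < N" for a
    using that nR by (auto simp: N_def less_mult_imp_div_less mult.commute)
  have WW: "W * herm W = 1\<^sub>m N"
  proof (rule eq_matI)
    fix a b assume "a < dim_row (1\<^sub>m N)" "b < dim_col (1\<^sub>m N)"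
    then have ab: "a < N" "b < N" by auto
    have "(W * herm W) $$ (a,b) = (\<Sum>c<nR*T. (if a mod nR = c div T then w (a div nR) (c mod T) else 0) *
        cnj (if b mod nR = c div T then w (b div nR) (c mod T) else 0))"
      using ab by (simp add: W_def herm_def scalar_prod_def N_def lessThan_atLeast0)
    also have "\<dots> = (\<Sum>i<nR. \<Sum>r<T. (if a mod nR = i then w (a div nR) r else 0) * cnj (if b mod nR = i then w (b div nR) r else 0))"
      by (rule sum_lessThan_mult_divmod)
    also have "\<dots> = (\<Sum>i<nR. if a mod nR = i then (if b mod nR = i then (\<Sum>r<T. w (a div nR) r * cnj (w (b div nR) r)) else 0) else 0)"
      by (intro sum.cong refl) auto
    also have "\<dots> = (if a mod nR = b mod nR then (\<Sum>r<T. w (a div nR) r * cnj (w (b div nR) r)) else 0)"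
      using divN[OF ab(1)] by simp
    also have "(\<Sum>r<T. w (a div nR) r * cnj (w (b div nR) r)) = (\<Sum>r<T. unit_root T (b div nR) ^ r * cnj (unit_root T (a div nR)) ^ r) / of_nat T"
      unfolding sum_divide_distrib by (intro sum.cong refl) (simp add: w_def sT mult.commute)
    also have "\<dots> = (if a div nR = b div nR then 1 else 0)"
      using divN[OF ab(1)] divN[OF ab(2)] cT by (subst sum_unit_root_orthogonal) auto
    also have "(if a mod nR = b mod nR then if a div nR = b div nR then 1 else 0 else 0) = (1\<^sub>m N :: complex mat) $$ (a,b)"
      using ab by (auto simp: one_mat_def) (metis div_mult_mod_eq)
    finally show "(W * herm W) $$ (a,b) = 1\<^sub>m N $$ (a,b)" .
  qed (use W hW in auto)
  have WH: "(W * H) $$ (a,b) = unit_root T (a div nR) ^ (b mod T) * dft_channel h T (a div nR) (a mod nR) (b div T)"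
    if ab: "a < N" "b < T * K" for a b
  proof -
    have "(W * H) $$ (a,b) = (\<Sum>c<nR*T. (if a mod nR = c div T then w (a div nR) (c mod T) else 0) * h (b div T, c div T, (c mod T + b mod T) mod T))"
      using ab by (simp add: W_def H_def eff_channel_def scalar_prod_def N_def lessThan_atLeast0)
    also have "\<dots> = (\<Sum>i<nR. \<Sum>r<T. (if a mod nR = i then w (a div nR) r else 0) * h (b div T, i, (r + b mod T) mod T))"
      by (rule sum_lessThan_mult_divmod)
    also have "\<dots> = (\<Sum>i<nR. if a mod nR = i then (\<Sum>r<T. w (a div nR) r * h (b div T, i, (r + b mod T) mod T)) else 0)"
      by (intro sum.cong refl) auto
    also have "\<dots> = (\<Sum>r<T. w (a div nR) r * h (b div T, a mod nR, (r + b mod T) mod T))"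
      using divN[OF ab(1)] by simp
    finally show ?thesis unfolding w_def dft_cyclic_shift[OF T] .
  qed
  let ?G = "\<lambda>f i j. (if i = j then 1 else 0) + complex_of_real \<rho> * (\<Sum>k<K. dft_channel h T f i k * cnj (dft_channel h T f j k))"
  let ?c = "complex_of_real (\<rho> / real T)"
  have WHC: "W * H \<in> carrier_mat N (T * K)" using W H by (rule mult_carrier_mat)
  have block: "1\<^sub>m N + ?c \<cdot>\<^sub>m ((W * H) * herm (W * H))
     = mat (T*nR) (T*nR) (\<lambda>(a,b). if a div nR = b div nR then ?G (a div nR) (a mod nR) (b mod nR) else 0)"
  proof (rule eq_matI)
    fix a b assume "a < dim_row (mat (T*nR) (T*nR) (\<lambda>(a,b). if a div nR = b div nR then ?G (a div nR) (a mod nR) (b mod nR) else 0))"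
      "b < dim_col (mat (T*nR) (T*nR) (\<lambda>(a,b). if a div nR = b div nR then ?G (a div nR) (a mod nR) (b mod nR) else 0))"
    then have ab: "a < N" "b < N" "a < T * nR" "b < T * nR" by (auto simp: N_def mult.commute)
    let ?d = "dft_channel h T"
    have "((W * H) * herm (W * H)) $$ (a,b) = (\<Sum>c<K*T. (W * H) $$ (a,c) * cnj ((W * H) $$ (b,c)))"
      using mult_herm_index[OF WHC ab(1,2)] by (simp only: mult.commute)
    also have "\<dots> = (\<Sum>c<K*T. unit_root T (a div nR) ^ (c mod T) * ?d (a div nR) (a mod nR) (c div T) *
         cnj (unit_root T (b div nR) ^ (c mod T) * ?d (b div nR) (b mod nR) (c div T)))"
      using ab by (intro sum.cong refl) (simp add: WH mult.commute)
    also have "\<dots> = (\<Sum>k<K. \<Sum>s<T. unit_root T (a div nR) ^ s * ?d (a div nR) (a mod nR) k *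
         cnj (unit_root T (b div nR) ^ s * ?d (b div nR) (b mod nR) k))"
      by (rule sum_lessThan_mult_divmod)
    \<comment> \<open>The inner sum over \<open>s\<close> is 0 for different frequencies and
      \<open>T\<close> for equal ones. This \<open>T\<close> cancels the denominator in
      \<open>?c\<close>, leaving \<open>rho\<close> itself as the scale of each block.\<close>
    also have "\<dots> = (\<Sum>k<K. (\<Sum>s<T. unit_root T (a div nR) ^ s * cnj (unit_root T (b div nR)) ^ s) *
         (?d (a div nR) (a mod nR) k * cnj (?d (b div nR) (b mod nR) k)))"
      unfolding sum_distrib_right by (simp add: mult_ac)
    also have "\<dots> = (if a div nR = b div nR then of_nat T * (\<Sum>k<K. ?d (a div nR) (a mod nR) k * cnj (?d (b div nR) (b mod nR) k)) else 0)"
      unfolding sum_unit_root_orthogonal[OF divN(1)[OF ab(1)] divN(1)[OF ab(2)]] by (simp add: sum_distrib_left)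
    finally have "((W * H) * herm (W * H)) $$ (a,b) = \<dots>" .
    moreover have "(1\<^sub>m N + ?c \<cdot>\<^sub>m ((W * H) * herm (W * H))) $$ (a,b) = (if a = b then 1 else 0) + ?c * ((W * H) * herm (W * H)) $$ (a,b)"
      by (rule one_plus_smult_index[OF mult_carrier_mat[OF WHC herm_carrier[OF WHC]] ab(1,2)])
    moreover have "a = b \<longleftrightarrow> a div nR = b div nR \<and> a mod nR = b mod nR" by (metis div_mult_mod_eq)
    moreover have "?c * (of_nat T * x) = complex_of_real \<rho> * x" for x using T by simp
    ultimately have "(1\<^sub>m N + ?c \<cdot>\<^sub>m ((W * H) * herm (W * H))) $$ (a,b)
      = (if a div nR = b div nR then ?G (a div nR) (a mod nR) (b mod nR) else 0)"
      by (cases "a div nR = b div nR") (simp_all only: if_True if_False simp_thms mult_zero_right add_0_right)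
    then show "(1\<^sub>m N + ?c \<cdot>\<^sub>m ((W * H) * herm (W * H))) $$ (a,b)
      = mat (T*nR) (T*nR) (\<lambda>(a,b). if a div nR = b div nR then ?G (a div nR) (a mod nR) (b mod nR) else 0) $$ (a,b)"
      using ab by simp
  qed (use WHC in \<open>auto simp: herm_def N_def mult.commute\<close>)
  have HH: "H * herm H \<in> carrier_mat N N" using H hH by (rule mult_carrier_mat)
  have cHH: "?c \<cdot>\<^sub>m (H * herm H) \<in> carrier_mat N N" using HH by auto
  have "(W * H) * herm (W * H) = W * (H * herm H) * herm W"
    using W H hW hH HH by (simp add: herm_mult[OF W H] assoc_mult_mat[OF W H mult_carrier_mat[OF hH hW]]
      assoc_mult_mat[OF H hH hW] assoc_mult_mat[OF W HH hW])
  then have "?c \<cdot>\<^sub>m ((W * H) * herm (W * H)) = W * (?c \<cdot>\<^sub>m (H * herm H)) * herm W"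
    by (simp add: mult_smult_distrib[OF W HH] mult_smult_assoc_mat[OF mult_carrier_mat[OF W HH] hW])
  then have "1\<^sub>m N + ?c \<cdot>\<^sub>m ((W * H) * herm (W * H)) = W * (1\<^sub>m N + ?c \<cdot>\<^sub>m (H * herm H)) * herm W"
    unfolding mult_add_distrib_mat[OF W one_carrier_mat cHH] right_mult_one_mat[OF W]
      add_mult_distrib_mat[OF W mult_carrier_mat[OF W cHH] hW] WW
    by (rule arg_cong)
  then have "Determinant.det (1\<^sub>m N + ?c \<cdot>\<^sub>m ((W * H) * herm (W * H)))
     = Determinant.det W * Determinant.det (1\<^sub>m N + ?c \<cdot>\<^sub>m (H * herm H)) * Determinant.det (herm W)"
    by (simp only: det_mult[OF W add_carrier_mat[OF cHH]] det_mult[OF mult_carrier_mat[OF W add_carrier_mat[OF cHH]] hW])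
  also have "\<dots> = Determinant.det (1\<^sub>m N + ?c \<cdot>\<^sub>m (H * herm H)) * Determinant.det (W * herm W)"
    unfolding det_mult[OF W hW] by (simp only: mult_ac)
  also have "\<dots> = Determinant.det (1\<^sub>m N + ?c \<cdot>\<^sub>m (H * herm H))" by (simp only: WW det_one mult_1_right)
  finally have "Determinant.det (1\<^sub>m N + ?c \<cdot>\<^sub>m (H * herm H))
     = (\<Prod>f<T. Determinant.det (mat nR nR (\<lambda>(i,j). ?G f i j)))"
    unfolding block det_block_diagonal[OF nR, of T ?G] by (rule sym)
  then show ?thesis unfolding gram_def N_def H_def .
qed

section \<open>The standard complex Gaussian measure\<close>

lemma nn_integral_exp_atLeast: "(\<integral>\<^sup>+u. ennreal (exp (-u)) * indicator {c..} u \<partial>lborel) = ennreal (exp (- c :: real))"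
proof -
  have "(\<integral>\<^sup>+u. ennreal (exp (-u)) * indicator {c..} u \<partial>lborel) = ennreal (0 - (- exp (-c)))"
    by (rule nn_integral_FTC_atLeast) (auto intro!: derivative_eq_intros, real_asymp)
  then show ?thesis by simp
qed

lemma nn_integral_mult_exp_atLeast:
  "(\<integral>\<^sup>+u. ennreal ((u - c) * exp (-u)) * indicator {c..} u \<partial>lborel) = ennreal (exp (- c :: real))"
proof -
  have "(\<integral>\<^sup>+u. ennreal ((u - c) * exp (-u)) * indicator {c..} u \<partial>lborel) = ennreal (0 - (- (c - c + 1) * exp (-c)))"
    by (rule nn_integral_FTC_atLeast[where F = "\<lambda>u. - (u - c + 1) * exp (-u)"])
       (auto intro!: derivative_eq_intros simp: algebra_simps, real_asymp)
  then show ?thesis by simp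
qed

abbreviation "CN \<equiv> std_complex_gaussian"

lemma space_CN [simp]: "space CN = UNIV" and sets_CN [measurable_cong, simp]: "sets CN = sets borel"
  by (simp_all add: std_complex_gaussian_def)

lemma emeasure_complex_annulus:
  assumes "0 \<le> a" "a \<le> u"
  shows "emeasure lborel {z::complex. a < (cmod z)\<^sup>2 \<and> (cmod z)\<^sup>2 \<le> u} = ennreal (pi * (u - a))"
proof -
  have "(cmod z)\<^sup>2 \<le> c \<longleftrightarrow> cmod z \<le> sqrt c" for z c
    by (metis abs_norm_cancel real_sqrt_abs real_sqrt_le_iff)
  then have eq: "{z::complex. a < (cmod z)\<^sup>2 \<and> (cmod z)\<^sup>2 \<le> u} = cball 0 (sqrt u) - cball 0 (sqrt a)"
    by (auto simp flip: not_le)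
  have sub: "cball 0 (sqrt a) \<subseteq> (cball 0 (sqrt u) :: complex set)"
    using assms by (intro subset_cball) simp
  have "emeasure lborel {z::complex. a < (cmod z)\<^sup>2 \<and> (cmod z)\<^sup>2 \<le> u}
     = emeasure lborel (cball 0 (sqrt u) :: complex set) - emeasure lborel (cball 0 (sqrt a) :: complex set)"
    unfolding eq by (intro emeasure_Diff sub) (use assms in \<open>auto simp: emeasure_cball\<close>)
  also have "\<dots> = ennreal (pi * u) - ennreal (pi * a)"
    using assms by (simp add: emeasure_cball unit_ball_vol_2)
  also have "\<dots> = ennreal (pi * (u - a))"
    using assms by (subst ennreal_minus) (auto simp: algebra_simps)
  finally show ?thesis .
qed

text \<open>A layer-cake argument in place of polar coordinates: \<open>exp (- |z|^2)\<close> is the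
  integral of \<open>exp (-u)\<close> over \<open>u \<ge> |z|^2\<close>. After exchanging the
  integrals, the integral over \<open>z\<close> is the area \<open>pi * (u - a)\<close> of an
  annulus, and an elementary integral in \<open>u\<close> remains.\<close>

lemma emeasure_CN_gt:
  assumes a: "0 \<le> a"
  shows "emeasure CN {z. a < (cmod z)\<^sup>2} = ennreal (exp (-a))"
proof -
  have "emeasure CN {z. a < (cmod z)\<^sup>2} = (\<integral>\<^sup>+z. ennreal (exp (- (cmod z)\<^sup>2) / pi) * indicator {z. a < (cmod z)\<^sup>2} z \<partial>lborel)"
    unfolding std_complex_gaussian_def by (subst emeasure_density) auto
  also have "\<dots> = (\<integral>\<^sup>+z. (\<integral>\<^sup>+u. ennreal (exp (-u)) * indicator {(cmod z)\<^sup>2..} u * (ennreal (1/pi) * indicator {z. a < (cmod z)\<^sup>2} z) \<partial>lborel) \<partial>lborel)"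
  proof (intro nn_integral_cong)
    fix z :: complex
    have "(\<integral>\<^sup>+u. ennreal (exp (-u)) * indicator {(cmod z)\<^sup>2..} u * (ennreal (1/pi) * indicator {z. a < (cmod z)\<^sup>2} z) \<partial>lborel)
      = ennreal (exp (- (cmod z)\<^sup>2)) * (ennreal (1/pi) * indicator {z. a < (cmod z)\<^sup>2} z)"
      by (subst nn_integral_multc) (auto simp: nn_integral_exp_atLeast)
    also have "\<dots> = ennreal (exp (- (cmod z)\<^sup>2) * (1/pi)) * indicator {z. a < (cmod z)\<^sup>2} z"
      by (subst ennreal_mult) (auto simp: mult.assoc)
    finally show "ennreal (exp (- (cmod z)\<^sup>2) / pi) * indicator {z. a < (cmod z)\<^sup>2} z =
      (\<integral>\<^sup>+u. ennreal (exp (-u)) * indicator {(cmod z)\<^sup>2..} u * (ennreal (1/pi) * indicator {z. a < (cmod z)\<^sup>2} z) \<partial>lborel)"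
      by simp
  qed
  also have "\<dots> = (\<integral>\<^sup>+z. (\<integral>\<^sup>+u. ennreal (exp (-u) / pi) * indicator {(z,u). a < (cmod z)\<^sup>2 \<and> (cmod z)\<^sup>2 \<le> u} (z,u) \<partial>lborel) \<partial>lborel)"
    by (intro nn_integral_cong) (auto simp: indicator_def ennreal_mult'[symmetric])
  also have "\<dots> = (\<integral>\<^sup>+u. (\<integral>\<^sup>+z. ennreal (exp (-u) / pi) * indicator {(z,u). a < (cmod z)\<^sup>2 \<and> (cmod z)\<^sup>2 \<le> u} (z,u) \<partial>lborel) \<partial>lborel)"
    by (rule lborel_pair.Fubini') (auto simp: split_beta')
  also have "\<dots> = (\<integral>\<^sup>+u. ennreal ((u - a) * exp (-u)) * indicator {a..} u \<partial>lborel)"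
  proof (intro nn_integral_cong)
    fix u :: real
    have "(\<integral>\<^sup>+z. ennreal (exp (-u) / pi) * indicator {(z::complex,u). a < (cmod z)\<^sup>2 \<and> (cmod z)\<^sup>2 \<le> u} (z,u) \<partial>lborel)
      = (\<integral>\<^sup>+z. ennreal (exp (-u) / pi) * indicator {z::complex. a < (cmod z)\<^sup>2 \<and> (cmod z)\<^sup>2 \<le> u} z \<partial>lborel)"
      by (intro nn_integral_cong) (auto simp: indicator_def)
    also have "\<dots> = ennreal (exp (-u) / pi) * emeasure lborel {z::complex. a < (cmod z)\<^sup>2 \<and> (cmod z)\<^sup>2 \<le> u}"
      by (subst nn_integral_cmult_indicator) auto
    also have "\<dots> = ennreal ((u - a) * exp (-u)) * indicator {a..} u"
    proof (cases "a \<le> u")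
      case True
      then show ?thesis using a
        by (subst emeasure_complex_annulus) (auto simp: ennreal_mult'[symmetric] mult_ac)
    next
      case False
      then have eq: "{z::complex. a < (cmod z)\<^sup>2 \<and> (cmod z)\<^sup>2 \<le> u} = {}" by auto
      then show ?thesis using False by (simp only: emeasure_empty) simp
    qed
    finally show "(\<integral>\<^sup>+z. ennreal (exp (-u) / pi) * indicator {(z::complex,u). a < (cmod z)\<^sup>2 \<and> (cmod z)\<^sup>2 \<le> u} (z,u) \<partial>lborel) = \<dots>" .
  qed
  also have "\<dots> = ennreal (exp (-a))" by (rule nn_integral_mult_exp_atLeast)
  finally show ?thesis .
qed

lemma prob_space_CN: "prob_space CN"
proof
  \<comment> \<open>The tail formula at 0 accounts for everything except the origin, which is a null
    set.\<close>
  have "emeasure CN (space CN) = emeasure CN ({z. 0 < (cmod z)\<^sup>2} \<union> {0})"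
    by (rule arg_cong[where f = "emeasure CN"]) auto
  also have "\<dots> = emeasure CN {z. 0 < (cmod z)\<^sup>2}"
  proof (rule emeasure_Un_null_set)
    show "{0} \<in> null_sets CN"
      unfolding std_complex_gaussian_def by (subst null_sets_density_iff) (auto simp: AE_lborel_singleton intro!: AE_I2)
  qed auto
  finally show "emeasure CN (space CN) = 1" using emeasure_CN_gt[of 0] by simp
qed

interpretation CN: prob_space CN by (rule prob_space_CN)

interpretation CN_prod: product_sigma_finite "\<lambda>_::'i. CN"
  by unfold_locales

lemma distributed_CN_norm_square: "distributed CN lborel (\<lambda>z. (cmod z)\<^sup>2) (exponential_density 1)"
proof (subst CN.exponential_distributed_iff, simp, intro conjI allI impI)
  fix a :: real assume a: "0 \<le> a"
  have "measure CN {z \<in> space CN. (cmod z)\<^sup>2 \<le> a} = 1 - measure CN {z. a < (cmod z)\<^sup>2}"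
    by (subst CN.prob_compl[symmetric]) (auto intro!: arg_cong[where f = "measure CN"])
  then show "measure CN {z \<in> space CN. (cmod z)\<^sup>2 \<le> a} = 1 - exp (- a * 1)"
    using emeasure_CN_gt[OF a] by (simp add: measure_def)
qed simp

section \<open>Unitary invariance\<close>

lemma nn_integral_lborel_shift:
  fixes f :: "complex \<Rightarrow> ennreal"
  assumes [measurable]: "f \<in> borel_measurable borel"
  shows "(\<integral>\<^sup>+x. f (x + t) \<partial>lborel) = (\<integral>\<^sup>+x. f x \<partial>lborel)"
proof -
  have "(\<integral>\<^sup>+x. f x \<partial>lborel) = (\<integral>\<^sup>+x. f x \<partial>distr lborel borel ((+) t))"
    by (simp add: lborel_distr_plus)
  also have "\<dots> = (\<integral>\<^sup>+x. f (t + x) \<partial>lborel)"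
    by (rule nn_integral_distr) auto
  finally show ?thesis by (simp add: add.commute)
qed

lemma nn_integral_lborel_shears:
  fixes F :: "complex \<times> complex \<Rightarrow> ennreal"
  assumes F [measurable]: "F \<in> borel_measurable (borel \<Otimes>\<^sub>M borel)"
  shows "(\<integral>\<^sup>+x. \<integral>\<^sup>+y. F (x, y + t * x) \<partial>lborel \<partial>lborel) = (\<integral>\<^sup>+x. \<integral>\<^sup>+y. F (x, y) \<partial>lborel \<partial>lborel)"
    and "(\<integral>\<^sup>+x. \<integral>\<^sup>+y. F (x + t * y, y) \<partial>lborel \<partial>lborel) = (\<integral>\<^sup>+x. \<integral>\<^sup>+y. F (x, y) \<partial>lborel \<partial>lborel)"
proof -
  show "(\<integral>\<^sup>+x. \<integral>\<^sup>+y. F (x, y + t * x) \<partial>lborel \<partial>lborel) = (\<integral>\<^sup>+x. \<integral>\<^sup>+y. F (x, y) \<partial>lborel \<partial>lborel)"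
    by (intro nn_integral_cong nn_integral_lborel_shift) measurable
  have "(\<integral>\<^sup>+x. \<integral>\<^sup>+y. F (x + t * y, y) \<partial>lborel \<partial>lborel) = (\<integral>\<^sup>+y. \<integral>\<^sup>+x. F (x + t * y, y) \<partial>lborel \<partial>lborel)"
    by (rule lborel_pair.Fubini') measurable
  also have "\<dots> = (\<integral>\<^sup>+y. \<integral>\<^sup>+x. F (x, y) \<partial>lborel \<partial>lborel)"
    by (intro nn_integral_cong nn_integral_lborel_shift) measurable
  also have "\<dots> = (\<integral>\<^sup>+x. \<integral>\<^sup>+y. F (x, y) \<partial>lborel \<partial>lborel)"
    by (rule lborel_pair.Fubini'[symmetric]) measurable
  finally show "(\<integral>\<^sup>+x. \<integral>\<^sup>+y. F (x + t * y, y) \<partial>lborel \<partial>lborel) = (\<integral>\<^sup>+x. \<integral>\<^sup>+y. F (x, y) \<partial>lborel \<partial>lborel)" .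
qed

text \<open>The rotation has determinant 1 and a nonzero off-diagonal entry, so it is a product of three
  shears, each of which preserves Lebesgue measure by Fubini and translation invariance.\<close>

lemma nn_integral_lborel_rotate:
  fixes F :: "complex \<times> complex \<Rightarrow> ennreal"
  assumes F [measurable]: "F \<in> borel_measurable (borel \<Otimes>\<^sub>M borel)"
    and ab: "a * cnj a + b * cnj b = 1" and b: "b \<noteq> 0"
  shows "(\<integral>\<^sup>+x. \<integral>\<^sup>+y. F (a * x + b * y, - cnj b * x + cnj a * y) \<partial>lborel \<partial>lborel) = (\<integral>\<^sup>+x. \<integral>\<^sup>+y. F (x, y) \<partial>lborel \<partial>lborel)"
proof -
  \<comment> \<open>The factorization is a shear of \<open>y\<close> by \<open>?t\<close>, then one
    of \<open>x\<close> by \<open>b\<close>, then one of \<open>y\<close> by \<open>?s\<close>.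
    Matching the first row of the rotation forces \<open>?t\<close>, matching the lower right entry
    forces \<open>?s\<close>, and \<open>ab\<close> then gives the lower left entry.\<close>
  let ?t = "(a - 1) / b" and ?s = "(cnj a - 1) / b"
  have 1: "x + b * (y + ?t * x) = a * x + b * y" for x y
    using b by (simp add: field_simps)
  have "?t + ?s * a = (a * cnj a - 1) / b"
    by (simp add: field_simps add_divide_distrib[symmetric] diff_divide_distrib[symmetric])
  also have "\<dots> = - cnj b"
    using b by (simp add: field_simps ab[symmetric])
  finally have ts: "?t + ?s * a = - cnj b" .
  have gen: "y + t * x + s * (a * x + b * y) = (t + s * a) * x + (1 + s * b) * y" for t s x y
    by (simp add: algebra_simps)
  have sb: "1 + ?s * b = cnj a" using b by simp
  have 2: "y + ?t * x + ?s * (a * x + b * y) = - cnj b * x + cnj a * y" for x y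
    unfolding gen ts sb ..
  have "(\<integral>\<^sup>+x. \<integral>\<^sup>+y. F (x, y) \<partial>lborel \<partial>lborel) = (\<integral>\<^sup>+x. \<integral>\<^sup>+y. F (x, y + ?s * x) \<partial>lborel \<partial>lborel)"
    by (rule nn_integral_lborel_shears(1)[symmetric]) measurable
  also have "\<dots> = (\<integral>\<^sup>+x. \<integral>\<^sup>+y. F (x + b * y, y + ?s * (x + b * y)) \<partial>lborel \<partial>lborel)"
    using nn_integral_lborel_shears(2)[of "\<lambda>(x,y). F (x, y + ?s * x)" b] by simp
  also have "\<dots> = (\<integral>\<^sup>+x. \<integral>\<^sup>+y. F (x + b * (y + ?t * x), y + ?t * x + ?s * (x + b * (y + ?t * x))) \<partial>lborel \<partial>lborel)"
    using nn_integral_lborel_shears(1)[of "\<lambda>(x,y). F (x + b * y, y + ?s * (x + b * y))" ?t] by simp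
  finally show ?thesis unfolding 1 2 ..
qed

lemma unitary_inner:
  fixes a b x y x' y' :: complex
  assumes "a * cnj a + b * cnj b = 1"
  shows "(a * x + b * y) * cnj (a * x' + b * y') + (- cnj b * x + cnj a * y) * cnj (- cnj b * x' + cnj a * y')
    = x * cnj x' + y * cnj y'"
proof -
  have "(a * x + b * y) * cnj (a * x' + b * y') + (- cnj b * x + cnj a * y) * cnj (- cnj b * x' + cnj a * y')
    = (a * cnj a + b * cnj b) * (x * cnj x' + y * cnj y')"
    by (simp add: algebra_simps)
  then show ?thesis using assms by simp
qed

text \<open>The joint density of two independent \<open>CN\<close> variables depends only on the sum
  of their squared moduli, which the rotation preserves; so the Lebesgue case applies to density
  times integrand.\<close>

lemma nn_integral_CN_rotate:
  fixes F :: "complex \<times> complex \<Rightarrow> ennreal"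
  assumes F [measurable]: "F \<in> borel_measurable (borel \<Otimes>\<^sub>M borel)"
    and ab: "a * cnj a + b * cnj b = 1" and b: "b \<noteq> 0"
  shows "(\<integral>\<^sup>+x. \<integral>\<^sup>+y. F (a * x + b * y, - cnj b * x + cnj a * y) \<partial>CN \<partial>CN) = (\<integral>\<^sup>+x. \<integral>\<^sup>+y. F (x, y) \<partial>CN \<partial>CN)"
proof -
  define D where "D = (\<lambda>(x::complex,y::complex). ennreal (exp (- ((cmod x)\<^sup>2 + (cmod y)\<^sup>2)) / pi\<^sup>2))"
  have D [measurable]: "D \<in> borel_measurable (borel \<Otimes>\<^sub>M borel)"
    unfolding D_def by measurable
  have *: "(\<integral>\<^sup>+x. \<integral>\<^sup>+y. H (x, y) \<partial>CN \<partial>CN) = (\<integral>\<^sup>+x. \<integral>\<^sup>+y. D (x, y) * H (x, y) \<partial>lborel \<partial>lborel)"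
    if [measurable]: "H \<in> borel_measurable (borel \<Otimes>\<^sub>M borel)" for H :: "complex \<times> complex \<Rightarrow> ennreal"
  proof -
    let ?e = "\<lambda>z. ennreal (exp (- (cmod z)\<^sup>2) / pi)"
    have H [measurable]: "(\<lambda>x. \<integral>\<^sup>+y. H (x, y) \<partial>CN) \<in> borel_measurable borel"
    proof (rule CN.borel_measurable_nn_integral_fst)
      show "H \<in> borel_measurable (borel \<Otimes>\<^sub>M CN)"
        using that by (subst measurable_cong_sets[OF sets_pair_measure_cong[OF refl sets_CN] refl])
    qed
    have "(\<integral>\<^sup>+x. \<integral>\<^sup>+y. H (x, y) \<partial>CN \<partial>CN) = (\<integral>\<^sup>+x. ?e x * (\<integral>\<^sup>+y. H (x, y) \<partial>CN) \<partial>lborel)"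
      by (subst (1) std_complex_gaussian_def, subst nn_integral_density) auto
    also have "\<dots> = (\<integral>\<^sup>+x. ?e x * (\<integral>\<^sup>+y. ?e y * H (x, y) \<partial>lborel) \<partial>lborel)"
      by (subst std_complex_gaussian_def, subst nn_integral_density) auto
    also have "\<dots> = (\<integral>\<^sup>+x. (\<integral>\<^sup>+y. ?e x * (?e y * H (x, y)) \<partial>lborel) \<partial>lborel)"
      by (subst nn_integral_cmult) auto
    also have "\<dots> = (\<integral>\<^sup>+x. \<integral>\<^sup>+y. D (x, y) * H (x, y) \<partial>lborel \<partial>lborel)"
      unfolding mult.assoc[symmetric]
      by (intro nn_integral_cong arg_cong2[where f = "(*)"] refl)
         (simp add: D_def ennreal_mult'[symmetric] exp_add[symmetric] power2_eq_square add.commute)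
    finally show ?thesis .
  qed
  have inv: "(cmod (a * x + b * y))\<^sup>2 + (cmod (- cnj b * x + cnj a * y))\<^sup>2 = (cmod x)\<^sup>2 + (cmod y)\<^sup>2" for x y
    using unitary_inner[OF ab, of x y x y]
    unfolding complex_norm_square[symmetric] of_real_add[symmetric] of_real_eq_iff .
  have "(\<integral>\<^sup>+x. \<integral>\<^sup>+y. F (a * x + b * y, - cnj b * x + cnj a * y) \<partial>CN \<partial>CN)
     = (\<integral>\<^sup>+x. \<integral>\<^sup>+y. D (x, y) * F (a * x + b * y, - cnj b * x + cnj a * y) \<partial>lborel \<partial>lborel)"
    using *[of "\<lambda>(x,y). F (a * x + b * y, - cnj b * x + cnj a * y)"] by simp
  also have "\<dots> = (\<integral>\<^sup>+x. \<integral>\<^sup>+y. D (a * x + b * y, - cnj b * x + cnj a * y) * F (a * x + b * y, - cnj b * x + cnj a * y) \<partial>lborel \<partial>lborel)"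
    by (simp only: D_def prod.case inv)
  also have "\<dots> = (\<integral>\<^sup>+x. \<integral>\<^sup>+y. D (x, y) * F (x, y) \<partial>lborel \<partial>lborel)"
    using nn_integral_lborel_rotate[of "\<lambda>p. D p * F p", OF _ ab b] by simp
  also have "\<dots> = (\<integral>\<^sup>+x. \<integral>\<^sup>+y. F (x, y) \<partial>CN \<partial>CN)"
    by (rule *[symmetric]) measurable
  finally show ?thesis .
qed

section \<open>Maps preserving the law of an i.i.d. Gaussian family, built from plane
  rotations\<close>

definition preserves :: "'s set \<Rightarrow> (('s \<Rightarrow> complex) \<Rightarrow> ('s \<Rightarrow> complex)) \<Rightarrow> bool" where
  "preserves S U \<longleftrightarrow> U \<in> PiM S (\<lambda>_. CN) \<rightarrow>\<^sub>M PiM S (\<lambda>_. CN) \<and>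
     (\<forall>f\<in>borel_measurable (PiM S (\<lambda>_. CN)). (\<integral>\<^sup>+x. f (U x) \<partial>PiM S (\<lambda>_. CN)) = (\<integral>\<^sup>+x. f x \<partial>PiM S (\<lambda>_. CN)))"

lemma preserves_nn_integral:
  "preserves S U \<Longrightarrow> f \<in> borel_measurable (PiM S (\<lambda>_. CN)) \<Longrightarrow>
    (\<integral>\<^sup>+x. f (U x) \<partial>PiM S (\<lambda>_. CN)) = (\<integral>\<^sup>+x. f x \<partial>PiM S (\<lambda>_. CN))"
  by (simp add: preserves_def)

lemma preserves_id: "preserves S (\<lambda>x. x)"
  by (simp add: preserves_def)

lemma preserves_comp:
  assumes "preserves S U" "preserves S V"
  shows "preserves S (\<lambda>x. U (V x))"
proof -
  have [measurable]: "U \<in> PiM S (\<lambda>_. CN) \<rightarrow>\<^sub>M PiM S (\<lambda>_. CN)" "V \<in> PiM S (\<lambda>_. CN) \<rightarrow>\<^sub>M PiM S (\<lambda>_. CN)"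
    using assms by (auto simp: preserves_def)
  have "(\<integral>\<^sup>+x. f (U (V x)) \<partial>PiM S (\<lambda>_. CN)) = (\<integral>\<^sup>+x. f x \<partial>PiM S (\<lambda>_. CN))"
    if [measurable]: "f \<in> borel_measurable (PiM S (\<lambda>_. CN))" for f
  proof -
    have "(\<lambda>x. f (U x)) \<in> borel_measurable (PiM S (\<lambda>_. CN))" by measurable
    from preserves_nn_integral[OF assms(2) this] preserves_nn_integral[OF assms(1) that]
    show ?thesis by simp
  qed
  then show ?thesis unfolding preserves_def by simp
qed

text \<open>One formula serves two index sets: the coordinates \<open>'s\<close> of the whole
  Gaussian family, where it preserves the measure, and the columns of a single row, where it
  preserves inner products.\<close>

definition givens :: "'s \<Rightarrow> 's \<Rightarrow> complex \<Rightarrow> complex \<Rightarrow> ('s \<Rightarrow> complex) \<Rightarrow> 's \<Rightarrow> complex" where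
  "givens i j a b x = x(i := a * x i + b * x j, j := - cnj b * x i + cnj a * x j)"

lemma preserves_givens:
  assumes S: "finite S" "i \<in> S" "j \<in> S" "i \<noteq> j" and ab: "a * cnj a + b * cnj b = 1" and b: "b \<noteq> 0"
  shows "preserves S (givens i j a b)"
proof -
  let ?M = "\<lambda>S. PiM S (\<lambda>_. CN)"
  have meas: "givens i j a b \<in> ?M S \<rightarrow>\<^sub>M ?M S"
  proof (rule measurable_PiM_single')
    fix k assume k: "k \<in> S"
    have [measurable]: "(\<lambda>x. x l) \<in> ?M S \<rightarrow>\<^sub>M borel" if "l \<in> S" for l
      using measurable_component_singleton[OF that, of "\<lambda>_. CN"] by (simp cong: measurable_cong_sets)
    show "(\<lambda>x. givens i j a b x k) \<in> ?M S \<rightarrow>\<^sub>M CN"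
      using S k by (cases "k = j"; cases "k = i") (simp_all add: givens_def cong: measurable_cong_sets)
  qed (use S in \<open>auto simp: givens_def space_PiM PiE_iff extensional_def\<close>)
  have "(\<integral>\<^sup>+x. f (givens i j a b x) \<partial>?M S) = (\<integral>\<^sup>+x. f x \<partial>?M S)" if f [measurable]: "f \<in> borel_measurable (?M S)" for f
  proof -
    define R where "R = S - {i, j}"
    have R: "finite R" "i \<notin> R" "j \<notin> insert i R" "finite (insert i R)" "S = insert j (insert i R)"
      using S by (auto simp: R_def)
    have upd: "(\<lambda>(x, y). x(k := y)) \<in> ?M T \<Otimes>\<^sub>M CN \<rightarrow>\<^sub>M ?M (insert k T)" for T and k :: 's
      by (rule measurable_add_dim)
    have *: "(\<integral>\<^sup>+x. h x \<partial>?M S) = (\<integral>\<^sup>+r. \<integral>\<^sup>+x. \<integral>\<^sup>+y. h (r(i := x, j := y)) \<partial>CN \<partial>CN \<partial>?M R)"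
      if h: "h \<in> borel_measurable (?M S)" for h
    proof -
      have h': "(\<lambda>(x, y). h (x(j := y))) \<in> borel_measurable (?M (insert i R) \<Otimes>\<^sub>M CN)"
        using measurable_compose[OF upd[of j "insert i R"], of h borel] h R(5) by (simp add: split_beta')
      have "(\<integral>\<^sup>+x. h x \<partial>?M S) = (\<integral>\<^sup>+x. \<integral>\<^sup>+y. h (x(j := y)) \<partial>CN \<partial>?M (insert i R))"
        using CN_prod.product_nn_integral_insert[OF R(4,3), of h] h R(5) by simp
      also have "\<dots> = (\<integral>\<^sup>+r. \<integral>\<^sup>+x. \<integral>\<^sup>+y. h (r(i := x, j := y)) \<partial>CN \<partial>CN \<partial>?M R)"
        by (rule CN_prod.product_nn_integral_insert[OF R(1,2)]) (rule CN.borel_measurable_nn_integral[OF h'])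
      finally show ?thesis .
    qed
    have "(\<integral>\<^sup>+x. f (givens i j a b x) \<partial>?M S)
       = (\<integral>\<^sup>+r. \<integral>\<^sup>+x. \<integral>\<^sup>+y. f (r(i := a * x + b * y, j := - cnj b * x + cnj a * y)) \<partial>CN \<partial>CN \<partial>?M R)"
      using *[of "\<lambda>x. f (givens i j a b x)"] measurable_compose[OF meas f] S(4)
      by (simp add: givens_def fun_upd_twist[of i j])
    also have "\<dots> = (\<integral>\<^sup>+r. \<integral>\<^sup>+x. \<integral>\<^sup>+y. f (r(i := x, j := y)) \<partial>CN \<partial>CN \<partial>?M R)"
    proof (rule nn_integral_cong)
      fix r assume r: "r \<in> space (?M R)"
      have "(\<lambda>p. f (r(i := fst p, j := snd p))) \<in> borel_measurable (borel \<Otimes>\<^sub>M borel)"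
      proof (rule measurable_compose[OF _ f])
        show "(\<lambda>p. r(i := fst p, j := snd p)) \<in> borel \<Otimes>\<^sub>M borel \<rightarrow>\<^sub>M ?M S"
          using r S R by (intro measurable_PiM_single') (auto simp: space_PiM PiE_iff extensional_def cong: measurable_cong_sets)
      qed
      from nn_integral_CN_rotate[OF this ab b]
      show "(\<integral>\<^sup>+x. \<integral>\<^sup>+y. f (r(i := a * x + b * y, j := - cnj b * x + cnj a * y)) \<partial>CN \<partial>CN)
         = (\<integral>\<^sup>+x. \<integral>\<^sup>+y. f (r(i := x, j := y)) \<partial>CN \<partial>CN)" by simp
    qed
    also have "\<dots> = (\<integral>\<^sup>+x. f x \<partial>?M S)" by (rule *[OF f, symmetric])
    finally show ?thesis .
  qed
  then show ?thesis using meas by (simp add: preserves_def)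
qed

text \<open>Here \<open>e l k\<close> is the coordinate of the family that stores the matrix entry
  in row \<open>l\<close> and column \<open>k\<close>. Injectivity makes the rows occupy disjoint
  coordinates, so the same rotation of columns \<open>i\<close> and \<open>j\<close> can be applied
  to one row after another.\<close>

lemma givens_rows:
  fixes e :: "'r \<Rightarrow> 'c \<Rightarrow> 's"
  assumes S: "finite S" and R: "finite R" and ij: "i \<in> J" "j \<in> J" "i \<noteq> j"
    and inj: "inj_on (\<lambda>(l,i). e l i) (R \<times> J)" and e: "\<And>l i. l \<in> R \<Longrightarrow> i \<in> J \<Longrightarrow> e l i \<in> S"
    and ab: "a * cnj a + b * cnj b = 1" and b: "b \<noteq> 0"
  obtains U where "preserves S U" "\<And>x l k. l \<in> R \<Longrightarrow> k \<in> J \<Longrightarrow> U x (e l k) = givens i j a b (\<lambda>k. x (e l k)) k"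
proof -
  \<comment> \<open>The last conjunct strengthens the induction: coordinates outside the rows
    treated so far are untouched, so the next row still has its original entries.\<close>
  have "\<exists>U. preserves S U \<and> (\<forall>x. \<forall>l\<in>R. \<forall>k\<in>J. U x (e l k) = givens i j a b (\<lambda>k. x (e l k)) k) \<and>
     (\<forall>x s. s \<notin> (\<lambda>(l,i). e l i) ` (R \<times> J) \<longrightarrow> U x s = x s)"
    using R inj e
  proof (induction R)
    case empty
    show ?case by (intro exI[of _ "\<lambda>x. x"]) (simp add: preserves_id)
  next
    case (insert l R)
    have "inj_on (\<lambda>(l,i). e l i) (R \<times> J)" by (rule inj_on_subset[OF insert.prems(1)]) auto
    moreover have "\<And>l i. l \<in> R \<Longrightarrow> i \<in> J \<Longrightarrow> e l i \<in> S" using insert.prems(2) by simp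
    ultimately have "\<exists>U. preserves S U \<and> (\<forall>x. \<forall>l\<in>R. \<forall>k\<in>J. U x (e l k) = givens i j a b (\<lambda>k. x (e l k)) k) \<and>
     (\<forall>x s. s \<notin> (\<lambda>(l,i). e l i) ` (R \<times> J) \<longrightarrow> U x s = x s)" by (rule insert.IH)
    then obtain U where U: "preserves S U" "\<forall>x. \<forall>l\<in>R. \<forall>k\<in>J. U x (e l k) = givens i j a b (\<lambda>k. x (e l k)) k"
     "\<forall>x s. s \<notin> (\<lambda>(l,i). e l i) ` (R \<times> J) \<longrightarrow> U x s = x s" by (elim exE conjE)
    have neq: "e l' k' \<noteq> e l k" if "l' \<in> R" "k \<in> J" "k' \<in> J" for l' k k'
      using inj_onD[OF insert.prems(1), of "(l',k')" "(l,k)"] insert.hyps(2) that by auto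
    have neq': "e l k = e l k' \<longleftrightarrow> k = k'" if "k \<in> J" "k' \<in> J" for k k'
      using inj_onD[OF insert.prems(1), of "(l,k)" "(l,k')"] that by auto
    have Ul: "U x (e l k) = x (e l k)" if "k \<in> J" for x k
    proof -
      have "e l k \<notin> (\<lambda>(l,i). e l i) ` (R \<times> J)" using neq that by force
      then show ?thesis using U(3) by blast
    qed
    have ne: "e l i \<noteq> e l j" "e l i \<in> S" "e l j \<in> S" using neq' ij insert.prems(2) by auto
    let ?V = "\<lambda>x. givens (e l i) (e l j) a b (U x)"
    show ?case
    proof (intro exI[of _ ?V] conjI allI ballI impI)
      show "preserves S ?V"
        using ne by (intro preserves_comp[OF _ U(1)] preserves_givens S ab b)
      fix x l' k assume "l' \<in> insert l R" "k \<in> J"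
      then consider "l' = l" | "l' \<in> R" by auto
      then show "?V x (e l' k) = givens i j a b (\<lambda>k. x (e l' k)) k"
      proof cases
        case 1
        then show ?thesis using neq' ij \<open>k \<in> J\<close> by (simp add: givens_def Ul)
      next
        case 2
        then have "?V x (e l' k) = U x (e l' k)"
          using neq[OF 2 ij(1) \<open>k \<in> J\<close>] neq[OF 2 ij(2) \<open>k \<in> J\<close>] by (simp add: givens_def)
        then show ?thesis using U(2) 2 \<open>k \<in> J\<close> by simp
      qed
    next
      fix x s assume s: "s \<notin> (\<lambda>(l,i). e l i) ` (insert l R \<times> J)"
      then have "s \<noteq> e l i" "s \<noteq> e l j" "s \<notin> (\<lambda>(l,i). e l i) ` (R \<times> J)" using ij by auto
      then show "?V x s = x s" using U(3) by (simp add: givens_def)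
    qed
  qed
  then show ?thesis using that by blast
qed

text \<open>Vectors are total functions here; the first conjunct makes \<open>u\<close> a map of
  vectors indexed by \<open>J\<close>. Preservation of inner products of pairs is the form in which
  Gram matrices and Fourier coefficients use unitarity.\<close>

definition unitary_on :: "'c set \<Rightarrow> (('c \<Rightarrow> complex) \<Rightarrow> 'c \<Rightarrow> complex) \<Rightarrow> bool" where
  "unitary_on J u \<longleftrightarrow> (\<forall>x y. (\<forall>i\<in>J. x i = y i) \<longrightarrow> (\<forall>i\<in>J. u x i = u y i)) \<and>
     (\<forall>x y. (\<Sum>i\<in>J. u x i * cnj (u y i)) = (\<Sum>i\<in>J. x i * cnj (y i)))"

lemma unitary_on_givens:
  fixes J :: "'c set"
  assumes J: "finite J" "i \<in> J" "j \<in> J" "i \<noteq> j" and ab: "a * cnj a + b * cnj b = 1" and u: "unitary_on J u"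
  shows "unitary_on J (\<lambda>x. givens i j a b (u x))"
proof -
  have inner: "(\<Sum>k\<in>J. givens i j a b x k * cnj (givens i j a b y k)) = (\<Sum>k\<in>J. x k * cnj (y k))" for x y
  proof -
    have split: "(\<Sum>k\<in>J. g k) = g i + g j + (\<Sum>k\<in>J - {i} - {j}. g k)" for g :: "_ \<Rightarrow> complex"
      using J by (simp add: sum.remove[of J i] sum.remove[of "J - {i}" j])
    have "(\<Sum>k\<in>J. givens i j a b x k * cnj (givens i j a b y k))
      = (a * x i + b * x j) * cnj (a * y i + b * y j) + (- cnj b * x i + cnj a * x j) * cnj (- cnj b * y i + cnj a * y j)
        + (\<Sum>k\<in>J - {i} - {j}. givens i j a b x k * cnj (givens i j a b y k))"
      using J(4) unfolding split by (simp add: givens_def)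
    also have "(\<Sum>k\<in>J - {i} - {j}. givens i j a b x k * cnj (givens i j a b y k)) = (\<Sum>k\<in>J - {i} - {j}. x k * cnj (y k))"
      by (intro sum.cong) (auto simp: givens_def)
    finally show ?thesis unfolding unitary_inner[OF ab] split[of "\<lambda>k. x k * cnj (y k)"] .
  qed
  show ?thesis
    unfolding unitary_on_def
  proof (intro conjI allI impI ballI)
    fix x y :: "'c \<Rightarrow> complex" and k assume "\<forall>i\<in>J. x i = y i" "k \<in> J"
    then have *: "\<forall>i\<in>J. u x i = u y i" using u unfolding unitary_on_def by blast
    show "givens i j a b (u x) k = givens i j a b (u y) k"
      using * J(2,3) \<open>k \<in> J\<close> by (simp add: givens_def)
  next
    fix x y
    show "(\<Sum>k\<in>J. givens i j a b (u x) k * cnj (givens i j a b (u y) k)) = (\<Sum>k\<in>J. x k * cnj (y k))"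
      using u unfolding inner unitary_on_def by blast
  qed
qed

text \<open>One Givens rotation per column \<open>j\<close> other than \<open>i\<close> moves the
  mass of \<open>v\<close> at \<open>j\<close> into position \<open>i\<close>. The map
  \<open>u\<close> acts on single rows, and \<open>U\<close> performs it on all rows stored in the
  family at once. The last clause controls the phase at \<open>i\<close>: a rotation leaves a
  positive number there, but if \<open>v\<close> already lies on the axis nothing is rotated and the
  original phase remains.\<close>

lemma exists_row_rotation:
  fixes e :: "'r \<Rightarrow> 'c \<Rightarrow> 's" and v :: "'c \<Rightarrow> complex"
  assumes S: "finite S" and R: "finite R" and J: "finite J" "i \<in> J"
    and inj: "inj_on (\<lambda>(l,i). e l i) (R \<times> J)" and e: "\<And>l i. l \<in> R \<Longrightarrow> i \<in> J \<Longrightarrow> e l i \<in> S"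
  obtains U u where "preserves S U" "unitary_on J u"
    "\<And>x l k. l \<in> R \<Longrightarrow> k \<in> J \<Longrightarrow> U x (e l k) = u (\<lambda>k. x (e l k)) k"
    "\<And>k. k \<in> J \<Longrightarrow> k \<noteq> i \<Longrightarrow> u v k = 0"
    "(\<exists>r\<ge>0. v i = complex_of_real r) \<longrightarrow> (\<exists>r\<ge>0. u v i = complex_of_real r)"
proof -
  have "\<exists>U u. preserves S U \<and> unitary_on J u \<and> (\<forall>x. \<forall>l\<in>R. \<forall>k\<in>J. U x (e l k) = u (\<lambda>k. x (e l k)) k) \<and>
     (\<forall>k\<in>J'. u v k = 0) \<and> ((\<exists>r\<ge>0. v i = complex_of_real r) \<longrightarrow> (\<exists>r\<ge>0. u v i = complex_of_real r))"
    if "finite J'" "J' \<subseteq> J - {i}" for J'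
    using that
  proof (induction J')
    case empty
    show ?case by (rule exI[of _ "\<lambda>x. x"], rule exI[of _ "\<lambda>x. x"]) (simp add: preserves_id unitary_on_def)
  next
    case (insert j J')
    then obtain U u where U: "preserves S U" and u: "unitary_on J u"
      and Uu: "\<forall>x. \<forall>l\<in>R. \<forall>k\<in>J. U x (e l k) = u (\<lambda>k. x (e l k)) k" and z: "\<forall>k\<in>J'. u v k = 0"
      and re: "(\<exists>r\<ge>0. v i = complex_of_real r) \<longrightarrow> (\<exists>r\<ge>0. u v i = complex_of_real r)" by auto
    have j: "j \<in> J" "i \<noteq> j" "i \<notin> J'" using insert by auto
    show ?case
    proof (cases "u v j = 0")
      case True
      with U u Uu z re show ?thesis by (intro exI[of _ U] exI[of _ u]) simp
    next
      case False
      define w where "w = u v"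
      define r where "r = sqrt ((cmod (w i))\<^sup>2 + (cmod (w j))\<^sup>2)"
      have r2: "r\<^sup>2 = (cmod (w i))\<^sup>2 + (cmod (w j))\<^sup>2" by (simp add: r_def)
      have r0: "r > 0" using False by (simp add: r_def w_def add_nonneg_pos)
      have cr: "complex_of_real r * complex_of_real r = w i * cnj (w i) + w j * cnj (w j)"
        unfolding complex_norm_square[symmetric] of_real_add[symmetric] of_real_mult[symmetric]
        using r2 by (simp add: power2_eq_square)
      \<comment> \<open>The first row of the rotation is the conjugate of \<open>(w i, w j)\<close>
        divided by its norm \<open>r\<close>: it sends this pair to \<open>r\<close>, and the second
        row sends it to 0.\<close>
      define a where "a = cnj (w i) / complex_of_real r"
      define b where "b = cnj (w j) / complex_of_real r"
      have b: "b \<noteq> 0" using False r0 by (simp add: b_def w_def)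
      have ab: "a * cnj a + b * cnj b = 1"
      proof -
        have "a * cnj a + b * cnj b = (w i * cnj (w i) + w j * cnj (w j)) / (complex_of_real r * complex_of_real r)"
          by (simp add: a_def b_def add_divide_distrib mult.commute)
        then show ?thesis using r0 unfolding cr[symmetric] by simp
      qed
      have wi: "a * w i + b * w j = complex_of_real r"
      proof -
        have "a * w i + b * w j = (w i * cnj (w i) + w j * cnj (w j)) / complex_of_real r"
          by (simp add: a_def b_def add_divide_distrib mult.commute)
        then show ?thesis using r0 unfolding cr[symmetric] by simp
      qed
      have wj: "- cnj b * w i + cnj a * w j = 0" by (simp add: a_def b_def)
      obtain V where V: "preserves S V" "\<And>x l k. l \<in> R \<Longrightarrow> k \<in> J \<Longrightarrow> V x (e l k) = givens i j a b (\<lambda>k. x (e l k)) k"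
        by (rule givens_rows[OF S R J(2) j(1,2) inj e ab b], assumption, assumption, rule that)
      show ?thesis
      proof (intro exI[of _ "\<lambda>x. V (U x)"] exI[of _ "\<lambda>x. givens i j a b (u x)"] conjI)
        show "preserves S (\<lambda>x. V (U x))" using V(1) U by (rule preserves_comp)
        show "unitary_on J (\<lambda>x. givens i j a b (u x))" by (rule unitary_on_givens[OF J j(1,2) ab u])
        show "\<forall>x. \<forall>l\<in>R. \<forall>k\<in>J. V (U x) (e l k) = givens i j a b (u (\<lambda>k. x (e l k))) k"
          using Uu J(2) j(1) by (auto simp: V(2) givens_def)
        show "\<forall>k\<in>insert j J'. givens i j a b (u v) k = 0"
          using z wj j by (auto simp: givens_def w_def)
        show "(\<exists>r\<ge>0. v i = complex_of_real r) \<longrightarrow> (\<exists>r\<ge>0. givens i j a b (u v) i = complex_of_real r)"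
          using wi r0 j(2) by (auto simp: givens_def w_def intro!: exI[of _ r])
      qed
    qed
  qed
  from this[of "J - {i}"] J show ?thesis using that by auto
qed

text \<open>The rotation takes the unit Fourier vector \<open>v\<close> to the unit vector at 0.
  Since \<open>u\<close> preserves inner products, coordinate 0 of a rotated row is the inner
  product of the original row with \<open>v\<close>, which is the Fourier coefficient.\<close>

lemma exists_dft_transform:
  assumes T: "T > 0"
  obtains U where "preserves ({..<K} \<times> {..<nR} \<times> {..<T}) U"
    "\<And>x k i. k < K \<Longrightarrow> i < nR \<Longrightarrow> U x (k, i, 0) = dft_channel x T f i k"
proof -
  let ?S = "{..<K} \<times> {..<nR} \<times> {..<T}" and ?e = "\<lambda>(k::nat, i::nat) (m::nat). (k, i, m)"
  define v where "v m = unit_root T f ^ m / complex_of_real (sqrt T)" for m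
  obtain U u where U: "preserves ?S U" and u: "unitary_on {..<T} u"
    and Uu: "\<And>x l k. l \<in> {..<K} \<times> {..<nR} \<Longrightarrow> k \<in> {..<T} \<Longrightarrow> U x (?e l k) = u (\<lambda>k. x (?e l k)) k"
    and z: "\<And>k. k \<in> {..<T} \<Longrightarrow> k \<noteq> 0 \<Longrightarrow> u v k = 0"
    and re: "(\<exists>r\<ge>0. v 0 = complex_of_real r) \<longrightarrow> (\<exists>r\<ge>0. u v 0 = complex_of_real r)"
    using T by (rule_tac exists_row_rotation[of ?S "{..<K} \<times> {..<nR}" "{..<T}" 0 ?e v])
      (auto simp: inj_on_def)
  \<comment> \<open>That this entry is real and nonnegative fixes the phase: \<open>u v\<close>
    becomes the unit vector itself and not a unimodular multiple of it.\<close>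
  have "v 0 = complex_of_real (1 / sqrt T)" by (simp add: v_def)
  with re obtain r where r: "r \<ge> 0" "u v 0 = complex_of_real r"
    by (metis divide_nonneg_nonneg of_nat_0_le_iff real_sqrt_ge_zero zero_le_one)
  have *: "(\<Sum>m<T. g m * cnj (u v m)) = g 0 * complex_of_real r" for g
    using T z r by (subst sum.remove[of _ 0]) (auto intro!: sum.neutral)
  have "complex_of_real (r * r) = (\<Sum>m<T. u v m * cnj (u v m))" unfolding * r(2) by simp
  also have "\<dots> = (\<Sum>m<T. v m * cnj (v m))" using u by (simp add: unitary_on_def)
  also have "\<dots> = (\<Sum>m<T. 1 / of_nat T)"
    by (intro sum.cong refl) (simp add: v_def unit_root_cnj flip: of_real_mult)
  also have "\<dots> = 1" using T by simp
  finally have "r * r = 1" using of_real_eq_1_iff by blast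
  then have "r = 1" using r(1) by (simp add: square_eq_1_iff)
  have "U x (k, i, 0) = dft_channel x T f i k" if "k < K" "i < nR" for x k i
  proof -
    have "U x (k, i, 0) = (\<Sum>m<T. u (\<lambda>m. x (k, i, m)) m * cnj (u v m))"
      unfolding * \<open>r = 1\<close> using Uu[of "(k,i)" 0 x] that T by simp
    also have "\<dots> = (\<Sum>m<T. x (k, i, m) * cnj (v m))" using u by (simp add: unitary_on_def)
    also have "\<dots> = dft_channel x T f i k" by (simp add: dft_channel_def v_def mult.commute)
    finally show ?thesis .
  qed
  with U show ?thesis using that by blast
qed

lemma borel_measurable_det_gram:
  assumes [measurable]: "\<And>l i. l < n \<Longrightarrow> i \<in> J \<Longrightarrow> (\<lambda>x. A x l i) \<in> borel_measurable M"
  shows "(\<lambda>x. Determinant.det (gram \<rho> J (A x) n)) \<in> borel_measurable M"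
proof -
  have eq: "Determinant.det (gram \<rho> J (A x) n) = (\<Sum>p | p permutes {0..<n}. signof p *
     (\<Prod>l = 0..<n. (if l = p l then 1 else 0) + complex_of_real \<rho> * (\<Sum>i\<in>J. A x l i * cnj (A x (p l) i))))" for x
    unfolding det_def'[OF gram_carrier]
    by (intro sum.cong refl arg_cong2[where f = "(*)"] prod.cong) (auto simp: gram_def permutes_in_image)
  show ?thesis
    unfolding eq
  proof (intro borel_measurable_sum borel_measurable_times borel_measurable_prod borel_measurable_add borel_measurable_const)
    fix p l i assume p: "p \<in> {p. p permutes {0..<n}}" "l \<in> {0..<n}" and i: "i \<in> J"
    then have "p l < n" by (auto simp: permutes_in_image)
    then show "(\<lambda>x. cnj (A x (p l) i)) \<in> borel_measurable M" "(\<lambda>x. A x l i) \<in> borel_measurable M"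
      using p i by (auto intro!: measurable_compose[OF assms borel_measurable_continuous_onI] continuous_intros)
  qed
qed

section \<open>Logarithmic moments of chi-square variables\<close>

lemma measurable_component_CN [measurable]: "q \<in> Q \<Longrightarrow> (\<lambda>v. v q) \<in> PiM Q (\<lambda>_. CN) \<rightarrow>\<^sub>M borel"
  using measurable_component_singleton[of q Q "\<lambda>_. CN"] by (simp cong: measurable_cong_sets)

lemma distributed_PiM_CN_norm_square:
  assumes q: "q \<in> Q"
  shows "distributed (PiM Q (\<lambda>_. CN)) lborel (\<lambda>v. (cmod (v q))\<^sup>2) (exponential_density 1)"
proof -
  have "distr (PiM Q (\<lambda>_. CN)) lborel (\<lambda>v. (cmod (v q))\<^sup>2)
     = distr (distr (PiM Q (\<lambda>_. CN)) CN (\<lambda>v. v q)) lborel (\<lambda>z. (cmod z)\<^sup>2)"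
    using q distributed_measurable[OF distributed_CN_norm_square]
    by (subst distr_distr) (auto simp: comp_def measurable_component_singleton)
  also have "\<dots> = distr CN lborel (\<lambda>z. (cmod z)\<^sup>2)"
    by (subst distr_PiM_component) (auto simp: q prob_space_CN)
  finally have d: "distr (PiM Q (\<lambda>_. CN)) lborel (\<lambda>v. (cmod (v q))\<^sup>2) = distr CN lborel (\<lambda>z. (cmod z)\<^sup>2)" .
  have "(\<lambda>v. (cmod (v q))\<^sup>2) \<in> PiM Q (\<lambda>_. CN) \<rightarrow>\<^sub>M lborel"
    using q by (simp cong: measurable_cong_sets)
  then show ?thesis
    unfolding distributed_def
    by (intro conjI trans[OF d distributed_distr_eq_density[OF distributed_CN_norm_square]]
        distributed_borel_measurable[OF distributed_CN_norm_square])
qed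

lemma indep_vars_PiM_CN:
  assumes "Q \<noteq> {}"
  shows "prob_space.indep_vars (PiM Q (\<lambda>_. CN)) (\<lambda>_. CN) (\<lambda>q v. v q) Q"
proof -
  interpret P: prob_space "PiM Q (\<lambda>_. CN)" by (intro prob_space_PiM prob_space_CN)
  have "distr (PiM Q (\<lambda>_. CN)) (PiM Q (\<lambda>_. CN)) (\<lambda>v. \<lambda>q\<in>Q. v q) = distr (PiM Q (\<lambda>_. CN)) (PiM Q (\<lambda>_. CN)) (\<lambda>v. v)"
    by (intro distr_cong refl) (auto simp: space_PiM PiE_def extensional_restrict)
  also have "\<dots> = PiM Q (\<lambda>q. distr (PiM Q (\<lambda>_. CN)) CN (\<lambda>v. v q))"
    unfolding distr_id by (intro PiM_cong refl distr_PiM_component[symmetric] prob_space_CN)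
  finally show ?thesis
    using assms by (subst P.indep_vars_iff_distr_eq_PiM') (auto simp: measurable_component_singleton)
qed

text \<open>The squared moduli are independent exponential variables of rate 1. The parameter is
  \<open>card Q - 1\<close> because \<open>erlang_density k\<close> has shape
  \<open>k + 1\<close>.\<close>

lemma distributed_sum_norm_square:
  assumes Q: "finite Q" "Q \<noteq> {}"
  shows "distributed (PiM Q (\<lambda>_. CN)) lborel (\<lambda>v. \<Sum>q\<in>Q. (cmod (v q))\<^sup>2) (erlang_density (card Q - 1) 1)"
proof -
  interpret P: prob_space "PiM Q (\<lambda>_. CN)" by (intro prob_space_PiM prob_space_CN)
  have "P.indep_vars (\<lambda>_. borel) (\<lambda>q v. (cmod (v q))\<^sup>2) Q"
    by (rule P.indep_vars_compose2[OF indep_vars_PiM_CN[OF Q(2)]])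
      (use distributed_measurable[OF distributed_CN_norm_square] in simp)
  then show ?thesis
    using Q by (intro P.exponential_distributed_sum distributed_PiM_CN_norm_square) auto
qed

lemma nn_integral_norm_square:
  assumes "q \<in> Q"
  shows "(\<integral>\<^sup>+v. ennreal ((cmod (v q))\<^sup>2) \<partial>PiM Q (\<lambda>_. CN)) = 1"
proof -
  have "(\<integral>\<^sup>+v. ennreal ((cmod (v q))\<^sup>2) \<partial>PiM Q (\<lambda>_. CN)) = (\<integral>\<^sup>+x. ennreal (exponential_density 1 x) * ennreal x \<partial>lborel)"
    by (rule distributed_nn_integral[OF distributed_PiM_CN_norm_square[OF assms], symmetric]) auto
  also have "\<dots> = (\<integral>\<^sup>+x. ennreal (erlang_density 0 1 x * x ^ 1) \<partial>lborel)"
    by (intro nn_integral_cong) (auto simp: ennreal_mult'[symmetric])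
  also have "\<dots> = 1" by (subst nn_integral_erlang_ith_moment) auto
  finally show ?thesis .
qed

text \<open>Multiplying the density by \<open>x powr (-t)\<close> shifts the exponent in the Gamma
  integral. The condition \<open>t < 1\<close> keeps the moment finite for every shape, including
  shape 1.\<close>

lemma nn_integral_erlang_powr:
  assumes t: "0 < t" "t < 1"
  shows "(\<integral>\<^sup>+x. ennreal (erlang_density k 1 x) * ennreal (x powr (-t)) \<partial>lborel) = ennreal (Gamma (real (Suc k) - t) / Gamma (real (Suc k)))"
proof -
  have G: "Gamma (real (Suc k)) = fact k" using Gamma_fact[of k, where 'a = real] by (simp add: add.commute)
  have Gp: "Gamma (real (Suc k) - t) > 0" using t by (intro Gamma_real_pos) auto
  have AE: "AE x in lborel. x \<noteq> (0::real)" by (rule AE_lborel_singleton)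
  have "(\<integral>\<^sup>+x. ennreal (erlang_density k 1 x) * ennreal (x powr (-t)) \<partial>lborel)
     = (\<integral>\<^sup>+x. ennreal (1 / fact k) * ennreal (indicator {0..} x * x powr (real (Suc k) - t - 1) / exp x) \<partial>lborel)"
  proof (rule nn_integral_cong_AE, rule AE_mp[OF AE], rule AE_I2, rule impI)
    fix x :: real assume "x \<noteq> 0"
    have "erlang_density k 1 x * x powr (-t) = 1 / fact k * (indicator {0..} x * x powr (real (Suc k) - t - 1) / exp x)"
    proof (cases "x > 0")
      case True
      then have "x powr (real (Suc k) - t - 1) = x ^ k * x powr (-t)"
        by (simp add: powr_realpow[symmetric] powr_add[symmetric])
      then show ?thesis using True by (simp add: erlang_density_def exp_minus field_simps)
    qed (use \<open>x \<noteq> 0\<close> in \<open>simp add: erlang_density_def\<close>)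
    then show "ennreal (erlang_density k 1 x) * ennreal (x powr (-t)) = ennreal (1 / fact k) * ennreal (indicator {0..} x * x powr (real (Suc k) - t - 1) / exp x)"
      by (simp only: ennreal_mult'[symmetric] powr_ge_zero erlang_density_nonneg zero_less_one fact_ge_zero zero_le_divide_1_iff)
  qed
  also have "\<dots> = ennreal (1 / fact k) * ennreal (Gamma (real (Suc k) - t))"
    using t by (subst nn_integral_cmult, simp, subst Gamma_conv_nn_integral_real) auto
  also have "\<dots> = ennreal (Gamma (real (Suc k) - t) / Gamma (real (Suc k)))"
    using Gp unfolding G by (subst ennreal_mult'[symmetric]) auto
  finally show ?thesis .
qed

text \<open>The pointwise form of Jensen's inequality: the tangent at \<open>c\<close> of the convex
  function \<open>ln (1 + rho * exp u)\<close>, evaluated at \<open>u = ln x\<close>. It follows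
  from concavity of \<open>ln\<close>, as \<open>(1 + rho * x) / (1 + rho * exp c)\<close> is the
  average of 1 and \<open>x / exp c\<close> with weights \<open>1 - p\<close> and
  \<open>p\<close>.\<close>

lemma ln_one_plus_tangent:
  fixes \<rho> c x :: real
  assumes \<rho>: "\<rho> > 0" and x: "x > 0"
  shows "ln (1 + \<rho> * exp c) + \<rho> * exp c / (1 + \<rho> * exp c) * (ln x - c) \<le> ln (1 + \<rho> * x)"
proof -
  define p where "p = \<rho> * exp c / (1 + \<rho> * exp c)"
  have pos: "1 + \<rho> * exp c > 0" "1 + \<rho> * x > 0" using \<rho> x by (simp_all add: add_pos_pos)
  have p: "0 \<le> p" "p \<le> 1" using \<rho> pos by (auto simp: p_def)
  have "(1 - p) * ln 1 + p * ln (x / exp c) \<le> ln ((1 - p) *\<^sub>R 1 + p *\<^sub>R (x / exp c))"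
    by (rule concave_onD[OF ln_concave p]) (use x in auto)
  also have "(1 - p) *\<^sub>R 1 + p *\<^sub>R (x / exp c) = (1 + \<rho> * x) / (1 + \<rho> * exp c)"
    using pos by (simp add: p_def field_simps)
  also have "ln \<dots> = ln (1 + \<rho> * x) - ln (1 + \<rho> * exp c)" using pos by (intro ln_divide_pos)
  also have "ln (x / exp c) = ln x - c" using x by (simp add: ln_div)
  finally show ?thesis by (simp add: p_def)
qed

lemma ln_ge_powr:
  fixes x t :: real
  assumes "x > 0" "t > 0"
  shows "(1 - x powr (-t)) / t \<le> ln x"
proof -
  have "ln (x powr (-t)) \<le> x powr (-t) - 1" using assms by (intro ln_le_minus_one) auto
  then have "- t * ln x \<le> x powr (-t) - 1" using assms by (simp add: ln_powr)
  then show ?thesis using assms by (simp add: field_simps)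
qed

lemma nn_integral_ln_sum_norm_square_ge:
  fixes Q :: "'a set"
  assumes Q: "finite Q" "Q \<noteq> {}" and \<rho>: "\<rho> > 0"
  shows "ennreal (ln (1 + \<rho> * exp (Digamma (real (card Q)))))
     \<le> (\<integral>\<^sup>+v. ennreal (ln (1 + \<rho> * (\<Sum>q\<in>Q. (cmod (v q))\<^sup>2))) \<partial>PiM Q (\<lambda>_. CN))"
proof -
  let ?M = "PiM Q (\<lambda>_. CN)"
  interpret P: prob_space ?M by (intro prob_space_PiM prob_space_CN)
  define X where "X v = (\<Sum>q\<in>Q. (cmod (v q))\<^sup>2)" for v :: "'a \<Rightarrow> complex"
  have X [measurable]: "X \<in> borel_measurable ?M" unfolding X_def by measurable
  have X0: "X v \<ge> 0" for v by (simp add: X_def sum_nonneg)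
  define m where "m = real (card Q)"
  have m: "m \<ge> 1" using Q by (simp add: m_def Suc_le_eq card_gt_0_iff)
  have card: "Suc (card Q - 1) = card Q" using Q by (simp add: card_gt_0_iff)
  define c where "c = Digamma m"
  define p where "p = \<rho> * exp c / (1 + \<rho> * exp c)"
  have p: "p \<ge> 0" using \<rho> by (simp add: p_def add_nonneg_nonneg)
  let ?I = "\<integral>\<^sup>+v. ennreal (ln (1 + \<rho> * X v)) \<partial>?M"
  let ?g = "\<lambda>t. (1 - Gamma (m - t) / Gamma m) / t"
  have distX: "distributed ?M lborel X (erlang_density (card Q - 1) 1)"
    unfolding X_def by (rule distributed_sum_norm_square[OF Q])
  have moment: "(\<integral>\<^sup>+v. ennreal (X v powr (-t)) \<partial>?M) = ennreal (Gamma (m - t) / Gamma m)" if t: "0 < t" "t < 1" for t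
    using distributed_nn_integral[OF distX, of "\<lambda>x. ennreal (x powr (-t))"] nn_integral_erlang_powr[OF t, of "card Q - 1"]
    unfolding card m_def by simp
  \<comment> \<open>The tangent inequality and the bound for \<open>ln\<close> hold for positive
    arguments only; at 0 the values of \<open>ln\<close> and \<open>powr\<close> are
    conventions.\<close>
  have pos: "AE v in ?M. X v > 0"
  proof -
    obtain q where q: "q \<in> Q" using Q by blast
    have "AE z in CN. z \<noteq> 0"
      unfolding std_complex_gaussian_def by (subst AE_density) (auto intro: AE_mp[OF AE_lborel_singleton[of 0]])
    then have "AE v in ?M. v q \<noteq> 0" using q by (intro AE_PiM_component prob_space_CN) auto
    then show ?thesis
    proof (rule AE_mp, intro AE_I2 impI)
      fix v :: "'a \<Rightarrow> complex" assume "v q \<noteq> 0"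
      then have "0 < (cmod (v q))\<^sup>2" by simp
      also have "\<dots> \<le> X v" unfolding X_def using Q q by (intro member_le_sum) auto
      finally show "X v > 0" .
    qed
  qed
  \<comment> \<open>\<open>E ln X\<close> is bounded below through \<open>ln x \<ge> (1 - x powr (-t)) / t\<close>, whose moments are quotients of
    Gamma values; letting \<open>t\<close> tend to 0 turns them into the logarithmic derivative of Gamma.\<close>
  have key: "ennreal (ln (1 + \<rho> * exp c) + p * (?g t - c)) \<le> ?I" if t: "0 < t" "t < 1" for t
  proof -
    let ?G = "Gamma (m - t) / Gamma m"
    have G0: "?G \<ge> 0" using t m by (intro divide_nonneg_pos less_imp_le Gamma_real_pos) auto
    \<comment> \<open>\<open>C\<close> collects the constant terms of the lower bound. The remaining
      term, \<open>p / t\<close> times \<open>X v powr (-t)\<close>, has a negative sign and is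
      moved to the other side, so that all integrands stay nonnegative.\<close>
    define C where "C = ln (1 + \<rho> * exp c) + p * (1 / t - c)"
    have "ennreal C = (\<integral>\<^sup>+v. ennreal C \<partial>?M)" by (simp add: P.emeasure_space_1)
    also have "\<dots> \<le> (\<integral>\<^sup>+v. ennreal (ln (1 + \<rho> * X v)) + ennreal (p / t) * ennreal (X v powr (-t)) \<partial>?M)"
    proof (rule nn_integral_mono_AE, rule AE_mp[OF pos], intro AE_I2 impI)
      fix v assume v: "X v > 0"
      have "C \<le> ln (1 + \<rho> * X v) + p / t * X v powr (-t)"
      proof -
        have "p * ((1 - X v powr (-t)) / t) \<le> p * ln (X v)" using ln_ge_powr[OF v t(1)] p by (rule mult_left_mono)
        moreover have "p * ((1 - X v powr (-t)) / t) = p * (1 / t) - p / t * X v powr (-t)"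
          by (simp add: diff_divide_distrib right_diff_distrib)
        ultimately show ?thesis
          using ln_one_plus_tangent[OF \<rho> v, of c, folded p_def] by (simp add: C_def right_diff_distrib)
      qed
      then have "ennreal C \<le> ennreal (ln (1 + \<rho> * X v) + p / t * X v powr (-t))" by (rule ennreal_leI)
      also have "\<dots> = ennreal (ln (1 + \<rho> * X v)) + ennreal (p / t) * ennreal (X v powr (-t))"
        using v \<rho> p t by (subst ennreal_plus) (auto simp: ennreal_mult'[symmetric])
      finally show "ennreal C \<le> \<dots>" .
    qed
    also have "\<dots> = ?I + ennreal (p / t) * (\<integral>\<^sup>+v. ennreal (X v powr (-t)) \<partial>?M)"
      by (subst nn_integral_add, simp, simp, subst nn_integral_cmult) simp_all
    also have "\<dots> = ?I + ennreal (p / t * ?G)"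
      unfolding moment[OF t] using p t G0 by (subst ennreal_mult) auto
    finally have C: "ennreal C \<le> ennreal (p / t * ?G) + ?I" by (simp only: add.commute)
    have "ennreal (C - p / t * ?G) = ennreal C - ennreal (p / t * ?G)"
      using p t by (intro ennreal_minus[symmetric] mult_nonneg_nonneg G0) simp
    also have "\<dots> \<le> ?I" using C by (simp only: ennreal_minus_le_iff ennreal_neq_top simp_thms)
    also have "C - p / t * ?G = ln (1 + \<rho> * exp c) + p * (?g t - c)"
      by (simp add: C_def diff_divide_distrib right_diff_distrib)
    finally show ?thesis .
  qed
  \<comment> \<open>\<open>?g t\<close> is minus the difference quotient of
    \<open>Gamma (m - t) / Gamma m\<close> at 0. The tangent point \<open>c\<close> is exactly its
    limit, so the linear term disappears.\<close>
  have lim: "((\<lambda>t. ennreal (ln (1 + \<rho> * exp c) + p * (?g t - c))) \<longlongrightarrow> ennreal (ln (1 + \<rho> * exp c) + p * (c - c))) (at_right 0)"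
  proof -
    have Gm: "Gamma m > 0" using m by (intro Gamma_real_pos) auto
    have "m \<notin> \<int>\<^sub>\<le>\<^sub>0" using m by (auto elim!: nonpos_Ints_cases)
    then have "((\<lambda>t. Gamma (m - t) / Gamma m) has_field_derivative - c) (at 0)"
      using Gm by (auto intro!: derivative_eq_intros simp: c_def)
    then have "((\<lambda>t. (Gamma (m - t) / Gamma m - Gamma (m - 0) / Gamma m) / (t - 0)) \<longlongrightarrow> - c) (at 0)"
      unfolding has_field_derivative_iff .
    then have "((\<lambda>t. - ((Gamma (m - t) / Gamma m - Gamma (m - 0) / Gamma m) / (t - 0))) \<longlongrightarrow> - (- c)) (at 0)"
      by (rule tendsto_minus)
    moreover have "- ((Gamma (m - t) / Gamma m - Gamma (m - 0) / Gamma m) / (t - 0)) = ?g t" for t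
      using Gm by (simp add: minus_divide_left)
    ultimately have "(?g \<longlongrightarrow> c) (at 0)" by simp
    then have "(?g \<longlongrightarrow> c) (at_right 0)" by (rule filterlim_mono) (auto simp: at_le)
    then show ?thesis by (intro tendsto_intros)
  qed
  have "ennreal (ln (1 + \<rho> * exp c) + p * (c - c)) \<le> ?I"
  proof (rule tendsto_upperbound[OF lim])
    show "\<forall>\<^sub>F t in at_right 0. ennreal (ln (1 + \<rho> * exp c) + p * (?g t - c)) \<le> ?I"
      using eventually_at_right_less[of 0] eventually_at_right_real[of 0 1]
      by (auto elim!: eventually_mono intro!: key)
  qed simp
  then show ?thesis by (simp add: c_def m_def X_def)
qed

section \<open>The ergodic rate\<close>

text \<open>A Gram matrix sees its rows only through their inner products, hence is unchanged when a
  unitary map acts on all rows.\<close>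

lemma gram_cong_inner:
  assumes "\<And>l m. l < n \<Longrightarrow> m < n \<Longrightarrow> (\<Sum>i\<in>J. A l i * cnj (A m i)) = (\<Sum>i\<in>J. B l i * cnj (B m i))"
  shows "gram \<rho> J A n = gram \<rho> J B n"
  using assms by (intro eq_matI) (auto simp: gram_def)

lemma gram_cong:
  assumes "\<And>l i. l < n \<Longrightarrow> i \<in> J \<Longrightarrow> A l i = B l i"
  shows "gram \<rho> J A n = gram \<rho> J B n"
  using assms by (intro gram_cong_inner sum.cong) auto

lemma Re_det_gram_ge_1:
  assumes "finite J" "\<rho> \<ge> 0"
  shows "1 \<le> Re (Determinant.det (gram \<rho> J A n))"
  using det_gram_bounds[OF assms, of A n] by (metis Re_complex_of_real)

text \<open>Induction on the number of rows, peeling off the last one. The embedding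
  \<open>e\<close> keeps the coordinate set \<open>S\<close> and the column set \<open>J\<close>
  arbitrary, so that both can shrink without renumbering, and allows \<open>S\<close> to contain
  coordinates outside the matrix.\<close>

lemma nn_integral_ln_det_gram_ge:
  fixes e :: "nat \<Rightarrow> 'c \<Rightarrow> 's"
  assumes \<rho>: "\<rho> > 0" and "finite S" "finite J" "n \<le> card J"
    and "inj_on (\<lambda>(l,i). e l i) ({..<n} \<times> J)" "\<And>l i. l < n \<Longrightarrow> i \<in> J \<Longrightarrow> e l i \<in> S"
  shows "ennreal (\<Sum>l<n. ln (1 + \<rho> * exp (Digamma (real (card J - l)))))
    \<le> (\<integral>\<^sup>+x. ennreal (ln (Re (Determinant.det (gram \<rho> J (\<lambda>l i. x (e l i)) n)))) \<partial>PiM S (\<lambda>_. CN))"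
  using assms(2-)
proof (induction n arbitrary: S J)
  case (Suc n S J)
  note S = Suc.prems(1) and J = Suc.prems(2) and inj = Suc.prems(4) and eS = Suc.prems(5)
  from Suc.prems(3) have "J \<noteq> {}" by auto
  then obtain i where i: "i \<in> J" by blast
  \<comment> \<open>\<open>Q\<close> holds the coordinates of the last row and \<open>S'\<close> all
    others; the product measure splits accordingly. The column \<open>i\<close>, an arbitrary one,
    is the axis onto which the last row is rotated.\<close>
  define Q where "Q = e n ` J"
  define S' where "S' = S - Q"
  define J' where "J' = J - {i}"
  have J': "finite J'" "card J' = card J - 1" "J' \<subseteq> J" using J i by (auto simp: J'_def)
  have inj_n: "inj_on (e n) J"
    using inj_onD[OF inj] by (intro inj_onI) fastforce
  have Q: "finite Q" "Q \<noteq> {}" "card Q = card J" "Q \<subseteq> S"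
    using J \<open>J \<noteq> {}\<close> eS by (auto simp: Q_def card_image[OF inj_n])
  have S': "finite S'" "Q \<inter> S' = {}" "Q \<union> S' = S" using S Q by (auto simp: S'_def)
  have eS': "e l k \<in> S'" if "l < n" "k \<in> J" for l k
  proof -
    have "e l k \<noteq> e n k'" if "k' \<in> J" for k'
      using inj_onD[OF inj, of "(l,k)" "(n,k')"] that \<open>l < n\<close> \<open>k \<in> J\<close> by auto
    then show ?thesis using that eS by (auto simp: S'_def Q_def)
  qed
  have inj': "inj_on (\<lambda>(l,i). e l i) ({..<n} \<times> J)" by (rule inj_on_subset[OF inj]) auto
  define g where "g A = ennreal (ln (Re (Determinant.det (gram \<rho> J A (Suc n)))))" for A
  define c where "c = (\<Sum>l<n. ln (1 + \<rho> * exp (Digamma (real (card J' - l)))))"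
  have c0: "c \<ge> 0" using \<rho> by (auto simp: c_def intro!: sum_nonneg)
  have IH: "ennreal c \<le> (\<integral>\<^sup>+y. ennreal (ln (Re (Determinant.det (gram \<rho> J' (\<lambda>l i. y (e l i)) n)))) \<partial>PiM S' (\<lambda>_. CN))"
    unfolding c_def
  proof (rule Suc.IH)
    show "n \<le> card J'" using Suc.prems(3) J' by simp
    show "inj_on (\<lambda>(l,i). e l i) ({..<n} \<times> J')" by (rule inj_on_subset[OF inj']) (use J' in auto)
  qed (use S' J' eS' in auto)
  interpret PS': prob_space "PiM S' (\<lambda>_. CN)" by (intro prob_space_PiM prob_space_CN)
  interpret PQ: prob_space "PiM Q (\<lambda>_. CN)" by (intro prob_space_PiM prob_space_CN)
  have meas: "(\<lambda>x. g (\<lambda>l i. x (e l i))) \<in> borel_measurable (PiM S (\<lambda>_. CN))"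
    unfolding g_def using eS
    by (intro measurable_compose[OF borel_measurable_det_gram[where M = "PiM S (\<lambda>_. CN)"]] measurable_component_CN) auto
  \<comment> \<open>The last row \<open>v\<close> is fixed here, and the rotation below is chosen
    for this value alone.\<close>
  have inner: "ennreal (ln (1 + \<rho> * (\<Sum>q\<in>Q. (cmod (v q))\<^sup>2))) + ennreal c
      \<le> (\<integral>\<^sup>+y. g (\<lambda>l i. merge Q S' (v, y) (e l i)) \<partial>PiM S' (\<lambda>_. CN))" for v
  proof -
    define v' where "v' k = v (e n k)" for k
    obtain U u where U: "preserves S' U" and u: "unitary_on J u"
      and Uu: "\<And>x l k. l \<in> {..<n} \<Longrightarrow> k \<in> J \<Longrightarrow> U x (e l k) = u (\<lambda>k. x (e l k)) k"
      and z: "\<And>k. k \<in> J \<Longrightarrow> k \<noteq> i \<Longrightarrow> u v' k = 0"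
      using exists_row_rotation[OF S'(1) finite_lessThan J i inj', of v'] eS' by (metis lessThan_iff)
    define B where "B a y l k = (if l = n then a k else y (e l k))" for a :: "'c \<Rightarrow> complex" and y :: "'s \<Rightarrow> complex" and l k
    have Bl: "B a y l = (\<lambda>k. y (e l k))" if "l < n" for a y l using that by (simp add: B_def fun_eq_iff)
    have Bn: "B a y n = a" for a y by (simp add: B_def fun_eq_iff)
    have 1: "g (\<lambda>l i. merge Q S' (v, y) (e l i)) = g (B v' y)" for y
    proof -
      have "gram \<rho> J (\<lambda>l i. merge Q S' (v, y) (e l i)) (Suc n) = gram \<rho> J (B v' y) (Suc n)"
        using eS' S'(2) by (intro gram_cong) (auto simp: B_def v'_def merge_def Q_def less_Suc_eq)
      then show ?thesis by (simp add: g_def)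
    qed
    \<comment> \<open>Rotating all \<open>n + 1\<close> rows by \<open>u\<close> leaves the Gram
      matrix unchanged; on the first \<open>n\<close> rows this rotation is the measure-preserving
      \<open>U\<close>.\<close>
    have 2: "g (B v' y) = g (B (u v') (U y))" for y
    proof -
      have "gram \<rho> J (B (u v') (U y)) (Suc n) = gram \<rho> J (\<lambda>l. u (B v' y l)) (Suc n)"
        by (intro gram_cong) (auto simp: Bl Bn Uu less_Suc_eq)
      also have "\<dots> = gram \<rho> J (B v' y) (Suc n)"
        using u by (intro gram_cong_inner) (simp add: unitary_on_def)
      finally show ?thesis by (simp add: g_def)
    qed
    have measB: "(\<lambda>y. g (B (u v') y)) \<in> borel_measurable (PiM S' (\<lambda>_. CN))"
      unfolding g_def
    proof (rule measurable_compose[OF borel_measurable_det_gram[where M = "PiM S' (\<lambda>_. CN)"]])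
      fix l k assume "l < Suc n" "k \<in> J"
      then show "(\<lambda>y. B (u v') y l k) \<in> borel_measurable (PiM S' (\<lambda>_. CN))"
        using eS' by (cases "l = n") (auto simp: B_def less_Suc_eq)
    qed auto
    have norm: "(cmod (u v' i))\<^sup>2 = (\<Sum>q\<in>Q. (cmod (v q))\<^sup>2)"
    proof -
      have "complex_of_real ((cmod (u v' i))\<^sup>2) = (\<Sum>k\<in>J. u v' k * cnj (u v' k))"
        using z J i by (subst sum.remove[of J i]) (auto simp: complex_norm_square[unfolded of_real_power] intro!: sum.neutral)
      also have "\<dots> = (\<Sum>k\<in>J. v' k * cnj (v' k))" using u by (simp add: unitary_on_def)
      also have "\<dots> = complex_of_real (\<Sum>k\<in>J. (cmod (v' k))\<^sup>2)" by (simp only: complex_norm_square of_real_sum)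
      finally have "(cmod (u v' i))\<^sup>2 = (\<Sum>k\<in>J. (cmod (v' k))\<^sup>2)" by (simp only: of_real_eq_iff)
      then show ?thesis by (simp add: Q_def sum.reindex[OF inj_n] v'_def)
    qed
    let ?r = "1 + \<rho> * (cmod (u v' i))\<^sup>2"
    have r1: "?r \<ge> 1" using \<rho> by simp
    \<comment> \<open>The rotated last row vanishes outside column \<open>i\<close>, which is the
      hypothesis of the Schur complement estimate.\<close>
    have 3: "ennreal (ln ?r) + ennreal (ln (Re (Determinant.det (gram \<rho> J' (\<lambda>l i. y (e l i)) n)))) \<le> g (B (u v') y)" for y
    proof -
      let ?d = "Re (Determinant.det (gram \<rho> J' (\<lambda>l i. y (e l i)) n))"
      have d1: "?d \<ge> 1" using J'(1) \<rho> by (intro Re_det_gram_ge_1) auto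
      have eq: "gram \<rho> J' (B (u v') y) n = gram \<rho> J' (\<lambda>l i. y (e l i)) n"
        by (intro gram_cong) (auto simp: B_def)
      have "?r * ?d \<le> Re (Determinant.det (gram \<rho> J (B (u v') y) (Suc n)))"
        using det_gram_Suc_ge[OF J i less_imp_le[OF \<rho>], of "B (u v') y" n] z
        unfolding J'_def[symmetric] eq by (simp add: B_def)
      then have "ln (?r * ?d) \<le> ln (Re (Determinant.det (gram \<rho> J (B (u v') y) (Suc n))))"
        using r1 d1 by (intro ln_mono) (auto intro!: mult_pos_pos)
      moreover have "ln (?r * ?d) = ln ?r + ln ?d" using r1 d1 by (intro ln_mult_pos) linarith+
      ultimately have "ennreal (ln ?r + ln ?d) \<le> g (B (u v') y)"
        unfolding g_def by (intro ennreal_leI) linarith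
      moreover have "ennreal (ln ?r + ln ?d) = ennreal (ln ?r) + ennreal (ln ?d)"
        by (intro ennreal_plus ln_ge_zero r1 d1)
      ultimately show ?thesis by simp
    qed
    have measJ': "(\<lambda>y. ennreal (ln (Re (Determinant.det (gram \<rho> J' (\<lambda>l i. y (e l i)) n))))) \<in> borel_measurable (PiM S' (\<lambda>_. CN))"
      using eS' J'(3)
      by (intro measurable_compose[OF borel_measurable_det_gram[where M = "PiM S' (\<lambda>_. CN)"]] measurable_component_CN) auto
    have "ennreal (ln (1 + \<rho> * (\<Sum>q\<in>Q. (cmod (v q))\<^sup>2))) + ennreal c
       \<le> (\<integral>\<^sup>+y. ennreal (ln ?r) \<partial>PiM S' (\<lambda>_. CN)) +
         (\<integral>\<^sup>+y. ennreal (ln (Re (Determinant.det (gram \<rho> J' (\<lambda>l i. y (e l i)) n)))) \<partial>PiM S' (\<lambda>_. CN))"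
      using IH unfolding norm by (intro add_mono) (simp_all add: PS'.emeasure_space_1)
    also have "\<dots> = (\<integral>\<^sup>+y. ennreal (ln ?r) + ennreal (ln (Re (Determinant.det (gram \<rho> J' (\<lambda>l i. y (e l i)) n)))) \<partial>PiM S' (\<lambda>_. CN))"
      by (rule nn_integral_add[OF borel_measurable_const measJ', symmetric])
    also have "\<dots> \<le> (\<integral>\<^sup>+y. g (B (u v') y) \<partial>PiM S' (\<lambda>_. CN))"
      by (intro nn_integral_mono 3)
    also have "\<dots> = (\<integral>\<^sup>+y. g (B (u v') (U y)) \<partial>PiM S' (\<lambda>_. CN))"
      by (rule preserves_nn_integral[OF U measB, symmetric])
    finally show ?thesis unfolding 1 2 .
  qed
  \<comment> \<open>The peeled row sees all \<open>card J\<close> columns and supplies the term with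
    index 0; the rest has one column fewer, which shifts its indices by 1.\<close>
  have sum_Suc: "(\<Sum>l<Suc n. ln (1 + \<rho> * exp (Digamma (real (card J - l))))) = ln (1 + \<rho> * exp (Digamma (real (card Q)))) + c"
    unfolding sum.lessThan_Suc_shift by (simp add: c_def J' Q)
  have "ennreal (\<Sum>l<Suc n. ln (1 + \<rho> * exp (Digamma (real (card J - l)))))
     = ennreal (ln (1 + \<rho> * exp (Digamma (real (card Q))))) + ennreal c"
    unfolding sum_Suc using \<rho> by (intro ennreal_plus ln_ge_zero c0) simp
  also have "\<dots> \<le> (\<integral>\<^sup>+v. ennreal (ln (1 + \<rho> * (\<Sum>q\<in>Q. (cmod (v q))\<^sup>2))) \<partial>PiM Q (\<lambda>_. CN)) + (\<integral>\<^sup>+v. ennreal c \<partial>PiM Q (\<lambda>_. CN))"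
    using nn_integral_ln_sum_norm_square_ge[OF Q(1,2) \<rho>] by (intro add_mono) (simp_all add: PQ.emeasure_space_1)
  also have "\<dots> = (\<integral>\<^sup>+v. ennreal (ln (1 + \<rho> * (\<Sum>q\<in>Q. (cmod (v q))\<^sup>2))) + ennreal c \<partial>PiM Q (\<lambda>_. CN))"
    by (rule nn_integral_add[symmetric]) measurable
  also have "\<dots> \<le> (\<integral>\<^sup>+v. \<integral>\<^sup>+y. g (\<lambda>l i. merge Q S' (v, y) (e l i)) \<partial>PiM S' (\<lambda>_. CN) \<partial>PiM Q (\<lambda>_. CN))"
    by (intro nn_integral_mono inner)
  also have "\<dots> = (\<integral>\<^sup>+x. g (\<lambda>l i. x (e l i)) \<partial>PiM S (\<lambda>_. CN))"
    using CN_prod.product_nn_integral_fold[OF S'(2) Q(1) S'(1), of "\<lambda>x. g (\<lambda>l i. x (e l i))"] meas S'(3) by simp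
  finally show ?case by (simp only: g_def)
qed simp

text \<open>By the Hadamard-type bound and \<open>ln (1 + s) \<le> s\<close>, the logarithm is at
  most \<open>rho\<close> times the sum of the squared moduli of all entries, each of mean
  1.\<close>

lemma nn_integral_ln_det_gram_finite:
  fixes e :: "nat \<Rightarrow> 'c \<Rightarrow> 's"
  assumes \<rho>: "\<rho> > 0" and J: "finite J" and e: "\<And>l i. l < n \<Longrightarrow> i \<in> J \<Longrightarrow> e l i \<in> S"
  shows "(\<integral>\<^sup>+x. ennreal (ln (Re (Determinant.det (gram \<rho> J (\<lambda>l i. x (e l i)) n)))) \<partial>PiM S (\<lambda>_. CN)) < \<infinity>"
proof -
  have meas: "(\<lambda>x. ennreal \<rho> * ennreal ((cmod (x (e l i)))\<^sup>2)) \<in> borel_measurable (PiM S (\<lambda>_. CN))"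
    if "l < n" "i \<in> J" for l i
    using measurable_component_CN[of "e l i" S] e that by simp
  have "(\<integral>\<^sup>+x. ennreal (ln (Re (Determinant.det (gram \<rho> J (\<lambda>l i. x (e l i)) n)))) \<partial>PiM S (\<lambda>_. CN))
     \<le> (\<integral>\<^sup>+x. (\<Sum>i\<in>J. \<Sum>l<n. ennreal \<rho> * ennreal ((cmod (x (e l i)))\<^sup>2)) \<partial>PiM S (\<lambda>_. CN))"
  proof (rule nn_integral_mono)
    fix x :: "'s \<Rightarrow> complex"
    obtain d where d: "Determinant.det (gram \<rho> J (\<lambda>l i. x (e l i)) n) = complex_of_real d" "1 \<le> d"
      "d \<le> (\<Prod>i\<in>J. 1 + \<rho> * (\<Sum>l<n. (cmod (x (e l i)))\<^sup>2))"
      by (rule det_gram_bounds[OF J less_imp_le[OF \<rho>]])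
    have nn: "0 \<le> \<rho> * (\<Sum>l<n. (cmod (x (e l i)))\<^sup>2)" for i using \<rho> by (simp add: sum_nonneg)
    have "ln d \<le> ln (\<Prod>i\<in>J. 1 + \<rho> * (\<Sum>l<n. (cmod (x (e l i)))\<^sup>2))" using d by (intro ln_mono) auto
    also have "\<dots> = (\<Sum>i\<in>J. ln (1 + \<rho> * (\<Sum>l<n. (cmod (x (e l i)))\<^sup>2)))"
    proof (rule ln_prod)
      show "1 + \<rho> * (\<Sum>l<n. (cmod (x (e l i)))\<^sup>2) \<noteq> 0" for i using nn[of i] by linarith
    qed (fact J)
    also have "\<dots> \<le> (\<Sum>i\<in>J. \<rho> * (\<Sum>l<n. (cmod (x (e l i)))\<^sup>2))"
      by (intro sum_mono ln_add_one_self_le_self nn)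
    finally have "ennreal (ln d) \<le> ennreal (\<Sum>i\<in>J. \<Sum>l<n. \<rho> * (cmod (x (e l i)))\<^sup>2)"
      unfolding sum_distrib_left by (rule ennreal_leI)
    also have "\<dots> = (\<Sum>i\<in>J. \<Sum>l<n. ennreal \<rho> * ennreal ((cmod (x (e l i)))\<^sup>2))"
      using \<rho> by (simp add: sum_nonneg ennreal_mult' flip: sum_ennreal)
    finally show "ennreal (ln (Re (Determinant.det (gram \<rho> J (\<lambda>l i. x (e l i)) n))))
      \<le> (\<Sum>i\<in>J. \<Sum>l<n. ennreal \<rho> * ennreal ((cmod (x (e l i)))\<^sup>2))" by (simp only: d Re_complex_of_real)
  qed
  also have "\<dots> = (\<Sum>i\<in>J. \<integral>\<^sup>+x. (\<Sum>l<n. ennreal \<rho> * ennreal ((cmod (x (e l i)))\<^sup>2)) \<partial>PiM S (\<lambda>_. CN))"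
    by (intro nn_integral_sum borel_measurable_sum meas) auto
  also have "\<dots> = (\<Sum>i\<in>J. \<Sum>l<n. \<integral>\<^sup>+x. ennreal \<rho> * ennreal ((cmod (x (e l i)))\<^sup>2) \<partial>PiM S (\<lambda>_. CN))"
    by (intro sum.cong[OF refl] nn_integral_sum meas) auto
  also have "\<dots> = (\<Sum>i\<in>J. \<Sum>l<n. ennreal \<rho>)"
  proof (intro sum.cong refl)
    fix i l assume il: "i \<in> J" "l \<in> {..<n}"
    then have "(\<lambda>x. ennreal ((cmod (x (e l i)))\<^sup>2)) \<in> borel_measurable (PiM S (\<lambda>_. CN))"
      using measurable_component_CN[of "e l i" S] e by simp
    then show "(\<integral>\<^sup>+x. ennreal \<rho> * ennreal ((cmod (x (e l i)))\<^sup>2) \<partial>PiM S (\<lambda>_. CN)) = ennreal \<rho>"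
      using e[of l i] il by (subst nn_integral_cmult) (simp_all add: nn_integral_norm_square)
  qed
  also have "\<dots> < \<infinity>" by (simp add: ennreal_mult_less_top of_nat_less_top)
  finally show ?thesis .
qed

text \<open>The measure-preserving transform stores the Fourier coefficients at the coordinates with
  third index 0. Thus \<open>F\<close> has the law of the same expression in those i.i.d.
  coordinates, and the other coordinates are integrated out.\<close>

lemma integral_ln_det_dft_channel_ge:
  fixes K nR T f :: nat and \<rho> :: real
  assumes T: "T > 0" and \<rho>: "\<rho> > 0"
  defines "F \<equiv> \<lambda>h. ln (Re (Determinant.det (gram \<rho> {..<K} (dft_channel h T f) nR)))"
  shows "integrable (channel_measure K nR T) F"
    and "(\<Sum>l<min nR K. ln (1 + \<rho> * exp (Digamma (real (max nR K - l))))) \<le> (\<integral>h. F h \<partial>channel_measure K nR T)"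
proof -
  let ?S = "{..<K} \<times> {..<nR} \<times> {..<T}"
  let ?M = "PiM ?S (\<lambda>_. CN)"
  define c where "c = (\<Sum>l<min nR K. ln (1 + \<rho> * exp (Digamma (real (max nR K - l)))))"
  have c0: "c \<ge> 0" using \<rho> by (auto simp: c_def intro!: sum_nonneg)
  define g where "g x = ennreal (ln (Re (Determinant.det (gram \<rho> {..<K} (\<lambda>i k. x (k, i, 0)) nR))))"
    for x :: "nat \<times> nat \<times> nat \<Rightarrow> complex"
  have F0: "F h \<ge> 0" for h
    unfolding F_def using \<rho> by (intro ln_ge_zero Re_det_gram_ge_1) auto
  have F [measurable]: "F \<in> borel_measurable ?M"
    unfolding F_def dft_channel_def
    by (intro measurable_compose[OF borel_measurable_det_gram[where M = ?M]] borel_measurable_sum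
        borel_measurable_times borel_measurable_const measurable_component_CN) auto
  obtain U where U: "preserves ?S U" "\<And>x k i. k < K \<Longrightarrow> i < nR \<Longrightarrow> U x (k, i, 0) = dft_channel x T f i k"
    using exists_dft_transform[OF T, of K nR f] by metis
  have g: "g \<in> borel_measurable ?M"
    unfolding g_def using T
    by (intro measurable_compose[OF borel_measurable_det_gram[where M = ?M]] measurable_component_CN) auto
  have "ennreal (F h) = g (U h)" for h
    unfolding F_def g_def using U(2)
    by (intro arg_cong[where f = "\<lambda>A. ennreal (ln (Re (Determinant.det A)))"] gram_cong) auto
  then have eq: "(\<integral>\<^sup>+h. ennreal (F h) \<partial>?M) = (\<integral>\<^sup>+x. g x \<partial>?M)"
    using preserves_nn_integral[OF U(1) g] by simp
  have fin: "(\<integral>\<^sup>+h. ennreal (F h) \<partial>?M) < \<infinity>"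
    unfolding eq g_def using nn_integral_ln_det_gram_finite[OF \<rho>, of "{..<K}" nR "\<lambda>i k. (k, i, 0)" ?S] T by simp
  have "ennreal c \<le> (\<integral>\<^sup>+x. g x \<partial>?M)"
  proof (cases "nR \<le> K")
    case True
    then have mm: "min nR K = nR" "max nR K = K" by auto
    show ?thesis
      using nn_integral_ln_det_gram_ge[OF \<rho>, of ?S "{..<K}" nR "\<lambda>i k. (k, i, 0)"] T True
      unfolding c_def g_def mm by (simp add: inj_on_def)
  next
    \<comment> \<open>With fewer users than receive antennas the Gram matrix is transposed, so that
      users become the rows and there are enough columns for all rows.\<close>
    case False
    then have mm: "min nR K = K" "max nR K = nR" by auto
    show ?thesis
      using nn_integral_ln_det_gram_ge[OF \<rho>, of ?S "{..<nR}" K "\<lambda>k i. (k, i, 0)"] T False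
      unfolding c_def g_def mm det_gram_transpose[of _ K _ nR] by (simp add: inj_on_def)
  qed
  then have ge: "ennreal c \<le> (\<integral>\<^sup>+h. ennreal (F h) \<partial>?M)" unfolding eq .
  have int: "integrable ?M F"
    using fin F0 by (intro integrableI_nonneg F AE_I2) auto
  have "(\<integral>\<^sup>+h. ennreal (F h) \<partial>?M) = ennreal (\<integral>h. F h \<partial>?M)"
    by (rule nn_integral_eq_integral[OF int]) (simp add: F0)
  with ge have "c \<le> (\<integral>h. F h \<partial>?M)"
    by (simp add: ennreal_le_iff integral_nonneg_AE F0)
  with int show "integrable (channel_measure K nR T) F"
    and "(\<Sum>l<min nR K. ln (1 + \<rho> * exp (Digamma (real (max nR K - l))))) \<le> (\<integral>h. F h \<partial>channel_measure K nR T)"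
    by (simp_all add: channel_measure_def c_def)
qed

theorem theorem1:
  fixes K nT nR :: nat and snr :: real
  assumes "K \<ge> 1" and "nT \<ge> 1" and "nR \<ge> 1" and "snr > 0"
  shows "cdd_rate K nR nT snr \<ge>
    (\<Sum>l = 1..min nR K. log 2 (1 + snr *
        exp ((\<Sum>k = 1..max nR K - l. 1 / real k) - (euler_mascheroni :: real))))"
proof -
  have T: "nT > 0" and nR: "nR > 0" using assms by auto
  let ?N = "channel_measure K nR nT"
  define F where "F f = (\<lambda>h. ln (Re (Determinant.det (gram snr {..<K} (dft_channel h nT f) nR))))" for f
  define c where "c = (\<Sum>l<min nR K. ln (1 + snr * exp (Digamma (real (max nR K - l)))))"
  have int: "integrable ?N (F f)" and ge: "c \<le> (\<integral>h. F f h \<partial>?N)" for f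
    unfolding F_def c_def
    using integral_ln_det_dft_channel_ge[OF T \<open>snr > 0\<close>, where K = K and nR = nR and f = f] .
  have "1 / real nT * log 2 (Re (Determinant.det (1\<^sub>m (nR * nT) + complex_of_real (snr / real nT) \<cdot>\<^sub>m
      (eff_channel h K nR nT * herm (eff_channel h K nR nT))))) = (\<Sum>f<nT. F f h) / (real nT * ln 2)" for h
  proof -
    let ?d = "\<lambda>f. Re (Determinant.det (gram snr {..<K} (dft_channel h nT f) nR))"
    \<comment> \<open>Each factor is real, so the real part of the product of determinants is the
      product of their real parts.\<close>
    have d: "Determinant.det (gram snr {..<K} (dft_channel h nT f) nR) = complex_of_real (?d f)" for f
      using det_gram_bounds[of "{..<K}" snr "dft_channel h nT f" nR] \<open>snr > 0\<close>
      by (metis Re_complex_of_real finite_lessThan less_imp_le)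
    have d1: "?d f \<ge> 1" for f using \<open>snr > 0\<close> by (intro Re_det_gram_ge_1) auto
    have "(\<Prod>f<nT. Determinant.det (gram snr {..<K} (dft_channel h nT f) nR)) = complex_of_real (\<Prod>f<nT. ?d f)"
      unfolding of_real_prod by (intro prod.cong refl d)
    then have "Re (Determinant.det (1\<^sub>m (nR * nT) + complex_of_real (snr / real nT) \<cdot>\<^sub>m
      (eff_channel h K nR nT * herm (eff_channel h K nR nT)))) = (\<Prod>f<nT. ?d f)"
      unfolding det_eff_channel[OF T nR] by (simp only: Re_complex_of_real)
    moreover have "ln (\<Prod>f<nT. ?d f) = (\<Sum>f<nT. F f h)"
      unfolding F_def
    proof (rule ln_prod)
      show "?d f \<noteq> 0" for f using d1[of f] by linarith
    qed simp
    ultimately show ?thesis by (simp only: log_def) simp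
  qed
  then have "cdd_rate K nR nT snr = (\<integral>h. (\<Sum>f<nT. F f h) / (real nT * ln 2) \<partial>?N)"
    unfolding cdd_rate_def by (simp only:)
  also have "\<dots> = (\<Sum>f<nT. \<integral>h. F f h \<partial>?N) / (real nT * ln 2)"
    using int by (simp add: Bochner_Integration.integral_sum)
  finally have rate: "cdd_rate K nR nT snr = (\<Sum>f<nT. \<integral>h. F f h \<partial>?N) / (real nT * ln 2)" .
  \<comment> \<open>The rate averages over the frequencies, and each of the \<open>nT\<close>
    summands obeys the same bound \<open>c\<close>.\<close>
  have "real nT * c \<le> (\<Sum>f<nT. \<integral>h. F f h \<partial>?N)"
    using sum_mono[of "{..<nT}" "\<lambda>_. c" "\<lambda>f. \<integral>h. F f h \<partial>?N"] ge by simp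
  then have "c / ln 2 \<le> cdd_rate K nR nT snr"
    unfolding rate using T by (simp add: field_simps)
  also have "c / ln 2 = (\<Sum>l<min nR K. log 2 (1 + snr * exp ((\<Sum>k = 1..max nR K - Suc l. 1 / real k) - euler_mascheroni)))"
    unfolding c_def sum_divide_distrib
  proof (intro sum.cong refl)
    fix l assume "l \<in> {..<min nR K}"
    \<comment> \<open>Digamma at \<open>n + 1\<close> is the \<open>n\<close>-th harmonic number
      minus \<open>euler_mascheroni\<close>; with \<open>l\<close> counted from 0 this gives
      \<open>n = max nR K - Suc l\<close>.\<close>
    then have "max nR K - l = Suc (max nR K - Suc l)" by auto
    then have "Digamma (real (max nR K - l)) = (\<Sum>k = 1..max nR K - Suc l. 1 / real k) - euler_mascheroni"
      using Digamma_of_nat[of "max nR K - Suc l", where 'a = real] by (simp only: harm_def inverse_eq_divide)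
    then show "ln (1 + snr * exp (Digamma (real (max nR K - l)))) / ln 2
      = log 2 (1 + snr * exp ((\<Sum>k = 1..max nR K - Suc l. 1 / real k) - euler_mascheroni))"
      by (simp only: log_def)
  qed
  also have "\<dots> = (\<Sum>l = 1..min nR K. log 2 (1 + snr * exp ((\<Sum>k = 1..max nR K - l. 1 / real k) - euler_mascheroni)))"
    by (rule sum.reindex_bij_witness[of _ "\<lambda>l. l - 1" Suc]) auto
  finally show ?thesis .
qed

end
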